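(* Let $A$ be a finite group, let $G$ be a finite group on which $A$ acts by group automorphisms, and let $p$ be a prime number. Let $\mathcal{R}$ denote the set of all $A$-normalized $G$-radical $p$-subgroups of $G$. For an $A$-normalized $p$-subgroup $H$ of $G$, let $C_{\mathcal{S}_{N_G(H)/H}^{p+*}}(A)$ denote the poset of nonidentity $A$-normalized $p$-subgroups of the $A$-group $N_G(H)/H$. (1) If $|C_G(A)_p|$ denotes the number of $p$-singular elements of $G$ centralized by $A$, then $$\sum_{H\in\mathcal{R}} -\widetilde{\chi}\bigl(C_{\mathcal{S}_{N_G(H)/H}^{p+*}}(A)\bigr)\,|C_H(A)| = |C_G(A)_p| .$$ (2) For any $H\in\mathcal{R}$, $$\sum_{K\in\mathcal{R},\ H\le K} -\widetilde{\chi}\bigl(C_{\mathcal{S}_{N_G(K)/K}^{p+*}}(A)\bigr) = 1 .$$ (3) If $|C_G(A)|_p$ denotes the $p$-part of the order of the centralizer subgroup $C_G(A)$, then $|C_G(A)|_p$ divides $\widetilde{\chi}\bigl(C_{\mathcal{S}_G^{p+*}}(A)\bigr)$, where $C_{\mathcal{S}_G^{p+*}}(A)$ is the poset of nonidentity $A$-normalized $p$-subgroups of $G$.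
   Context: A subgroup $H\le G$ is $A$-normalized if $H^a=H$ for all $a\in A$. If $H$ is $A$-normalized then so is $N_G(H)$, and $N_G(H)/H$ inherits an action of $A$. For a subgroup $H$ of $G$, $C_H(A)=\{h\in H\mid h^a=h \text{ for all } a\in A\}$. An element of a finite group is $p$-singular if its order is a power of $p$ (including order $1$). $O_p(L)$ is the largest normal $p$-subgroup of a finite group $L$; a $p$-subgroup $H$ of $G$ is $G$-radical if $H=O_p(N_G(H))$ (the trivial subgroup is allowed). Posets of subgroups are ordered by inclusion. For a finite poset $\mathcal{S}$, $\chi(\mathcal{S})$ is the usual Euler characteristic of its order complex (with $\chi(\emptyset)=0$) and $\widetilde{\chi}(\mathcal{S})=\chi(\mathcal{S})-1$. *)

theory Defs
  imports "HOL-Algebra.Algebra" "HOL-Computational_Algebra.Primes"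
begin

text \<open>
  An action of \<open>A\<close> on \<open>G\<close> by group automorphisms is a homomorphism
  \<open>\<phi> \<in> hom A (AutoGroup G)\<close>. This is a left action; a right action \<open>h\<^sup>a\<close> corresponds
  to \<open>\<phi> (inv a) h\<close>, and neither invariance nor fixed points depend on this choice.
\<close>

definition normalized_by :: "('c, 'd) monoid_scheme \<Rightarrow> ('c \<Rightarrow> 'a \<Rightarrow> 'a) \<Rightarrow> 'a set \<Rightarrow> bool"
  where "normalized_by A \<phi> H \<longleftrightarrow> (\<forall>a\<in>carrier A. \<phi> a ` H = H)"

definition fixed_points :: "('c, 'd) monoid_scheme \<Rightarrow> ('c \<Rightarrow> 'a \<Rightarrow> 'a) \<Rightarrow> 'a set \<Rightarrow> 'a set"
  where "fixed_points A \<phi> H = {h \<in> H. \<forall>a\<in>carrier A. \<phi> a h = h}"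

definition p_subgroup :: "nat \<Rightarrow> 'a set \<Rightarrow> ('a, 'b) monoid_scheme \<Rightarrow> bool"
  where "p_subgroup p H G \<longleftrightarrow> subgroup H G \<and> (\<exists>n. card H = p ^ n)"

definition p_singular :: "nat \<Rightarrow> ('a, 'b) monoid_scheme \<Rightarrow> 'a \<Rightarrow> bool"
  where "p_singular p G x \<longleftrightarrow> x \<in> carrier G \<and> (\<exists>n. group.ord G x = p ^ n)"

text \<open>\<open>O\<^sub>p(L)\<close>; the order on subgroups is inclusion.\<close>

definition p_core :: "nat \<Rightarrow> ('a, 'b) monoid_scheme \<Rightarrow> 'a set"
  where "p_core p L = (GREATEST P. P \<lhd> L \<and> p_subgroup p P L)"

definition normalizer_group ::
    "('a, 'b) monoid_scheme \<Rightarrow> 'a set \<Rightarrow> ('a, 'b) monoid_scheme"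
  where "normalizer_group G H = G\<lparr>carrier := normalizer G H\<rparr>"

definition radical_p_subgroup :: "nat \<Rightarrow> 'a set \<Rightarrow> ('a, 'b) monoid_scheme \<Rightarrow> bool"
  where "radical_p_subgroup p H G \<longleftrightarrow>
    p_subgroup p H G \<and> H = p_core p (normalizer_group G H)"

definition normalized_radicals ::
    "('c, 'd) monoid_scheme \<Rightarrow> ('c \<Rightarrow> 'a \<Rightarrow> 'a) \<Rightarrow> nat \<Rightarrow> ('a, 'b) monoid_scheme \<Rightarrow> 'a set set"
  where "normalized_radicals A \<phi> p G =
    {H. radical_p_subgroup p H G \<and> normalized_by A \<phi> H}"

definition normalized_p_poset ::
    "('c, 'd) monoid_scheme \<Rightarrow> ('c \<Rightarrow> 'a \<Rightarrow> 'a) \<Rightarrow> nat \<Rightarrow> ('a, 'b) monoid_scheme \<Rightarrow> 'a set set"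
  where "normalized_p_poset A \<phi> p G =
    {P. p_subgroup p P G \<and> P \<noteq> {\<one>\<^bsub>G\<^esub>} \<and> normalized_by A \<phi> P}"

definition normalizer_quotient ::
    "('a, 'b) monoid_scheme \<Rightarrow> 'a set \<Rightarrow> 'a set monoid"
  where "normalizer_quotient G H = normalizer_group G H Mod H"

text \<open>The elements of the quotient are cosets, on which \<open>A\<close> acts by taking images.\<close>

definition quotient_action ::
    "('a, 'b) monoid_scheme \<Rightarrow> ('c \<Rightarrow> 'a \<Rightarrow> 'a) \<Rightarrow> 'a set \<Rightarrow> 'c \<Rightarrow> 'a set \<Rightarrow> 'a set"
  where "quotient_action G \<phi> H a = (\<lambda>N\<in>carrier (normalizer_quotient G H). \<phi> a ` N)"

text \<open>
  The simplices of the order complex are the nonempty finite chains; a chain \<open>C\<close> has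
  dimension \<open>card C - 1\<close>. The Euler characteristic is meant for finite posets.
\<close>

definition order_complex :: "'a::order set \<Rightarrow> 'a set set"
  where "order_complex S =
    {C. C \<noteq> {} \<and> finite C \<and> C \<subseteq> S \<and> Complete_Partial_Order.chain (\<le>) C}"

definition euler_char :: "'a::order set \<Rightarrow> int"
  where "euler_char S = (\<Sum>C\<in>order_complex S. (- 1) ^ (card C - 1))"

definition reduced_euler_char :: "'a::order set \<Rightarrow> int"
  where "reduced_euler_char S = euler_char S - 1"

end

theory Submission
  imports Defs
begin

text \<open>
  Let \<open>S\<close> be the poset of all \<open>A\<close>-normalized \<open>p\<close>-subgroups of \<open>G\<close>, and for \<open>K \<in> S\<close> let \<open>w(K)\<close>
  be the negative of the reduced Euler characteristic of \<open>{L \<in> S. K \<subset> L}\<close>. Equivalently,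
  \<open>w(K)\<close> is the sum of \<open>(- 1)\<^bsup>|C|\<^esup>\<close> over all chains \<open>C\<close> in that poset, the empty one included.
  Cutting off the least element of a chain shows that the sum of \<open>w(K)\<close> over all \<open>K \<in> S\<close>
  containing a given \<open>H \<in> S\<close> is 1 (\<open>sum_upper_intervals_above\<close>).

  The weights \<open>w(K)\<close> are the coefficients in the theorem. Indeed, \<open>L \<mapsto> N\<^sub>L(K)\<close> retracts
  \<open>{L \<in> S. K \<subset> L}\<close> to those \<open>L\<close> that normalize \<open>K\<close> without changing the Euler characteristic,
  because normalizers grow in \<open>p\<close>-groups, and these \<open>L\<close> correspond to the nonidentity
  \<open>A\<close>-normalized \<open>p\<close>-subgroups of \<open>N\<^sub>G(K)/K\<close>. If \<open>K\<close> is not radical, then \<open>Q = O\<^sub>p(N\<^sub>G(K))\<close> is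
  one of these \<open>L\<close>, and \<open>L \<subseteq> Q L \<supseteq> Q\<close> is a conical contraction, so that \<open>w(K) = 0\<close>. This gives
  the second formula. The first follows by exchanging sums: \<open>x \<in> C\<^sub>G(A)\<close> lies in \<open>K\<close> if and only
  if \<open>K\<close> contains the cyclic group generated by \<open>x\<close>, which is in \<open>S\<close> if and only if \<open>x\<close> is
  \<open>p\<close>-singular.

  For the third formula, let a Sylow \<open>p\<close>-subgroup \<open>P\<close> of \<open>C\<^sub>G(A)\<close> act by conjugation on the
  chains of nonidentity members of \<open>S\<close>. Chains with trivial stabilizer come in orbits of
  size \<open>|P|\<close>. The others cancel, by Moebius inversion over the nontrivial subgroups \<open>Q\<close> of \<open>P\<close>:
  the chains fixed by \<open>Q\<close> are those of the subposet of members normalized by \<open>Q\<close>, which is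
  conically contractible through \<open>L \<subseteq> L Q \<supseteq> Q\<close>.

  All the contractions are carried out by deleting points whose link is a cone
  (\<open>alt_chain_sum_dismantle\<close>), so no topology is involved.
\<close>

section \<open>Alternating chain counts in finite posets\<close>

definition chains_in :: "'a::order set \<Rightarrow> 'a set set"
  where "chains_in S = {C. C \<subseteq> S \<and> Complete_Partial_Order.chain (\<le>) C}"

text \<open>
  Counting the empty chain as well gives the negative of the reduced Euler characteristic
  of a finite poset, and frees the formula for deleting a point from a constant term.
\<close>

definition alt_chain_sum :: "'a::order set \<Rightarrow> int"
  where "alt_chain_sum S = (\<Sum>C\<in>chains_in S. (- 1) ^ card C)"

lemma finite_chains_in: "finite S \<Longrightarrow> finite (chains_in S)"
  by (rule finite_subset[of _ "Pow S"]) (auto simp: chains_in_def)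

lemma alt_chain_sum_eq_reduced_euler_char:
  assumes "finite S"
  shows "alt_chain_sum S = - reduced_euler_char S"
proof -
  have fin: "finite C" if "C \<subseteq> S" for C
    using that assms by (rule finite_subset)
  have eq: "chains_in S = insert {} (order_complex S)"
    by (auto simp: chains_in_def order_complex_def chain_empty fin)
  have notin: "{} \<notin> order_complex S"
    by (simp add: order_complex_def)
  have "finite (order_complex S)"
    using finite_chains_in[OF assms] eq by simp
  then have "alt_chain_sum S = 1 + (\<Sum>C\<in>order_complex S. (- 1) ^ card C)"
    using notin by (simp add: alt_chain_sum_def eq)
  also have "(\<Sum>C\<in>order_complex S. (- 1) ^ card C)
      = (\<Sum>C\<in>order_complex S. - ((- 1) ^ (card C - 1)) :: int)"
  proof (rule sum.cong[OF refl])
    fix C assume "C \<in> order_complex S"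
    then have "card C > 0"
      by (auto simp: order_complex_def card_gt_0_iff)
    then show "(- 1) ^ card C = - ((- 1 :: int) ^ (card C - 1))"
      by (cases "card C") auto
  qed
  finally show ?thesis
    by (simp add: reduced_euler_char_def euler_char_def sum_negf)
qed

lemma alt_chain_sum_empty [simp]: "alt_chain_sum {} = 1"
proof -
  have "chains_in {} = {{} :: 'a set}"
    by (auto simp: chains_in_def chain_empty)
  then show ?thesis by (simp add: alt_chain_sum_def)
qed

text \<open>
  The chains through \<open>x\<close> arise by adding \<open>x\<close> to the chains of its link, the set of
  elements strictly comparable with \<open>x\<close>; adding \<open>x\<close> changes the sign.
\<close>

lemma alt_chain_sum_remove:
  assumes "finite S" "x \<in> S"
  shows "alt_chain_sum S = alt_chain_sum (S - {x}) - alt_chain_sum {y \<in> S. x < y \<or> y < x}"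
proof -
  let ?L = "{y \<in> S. x < y \<or> y < x}"
  have split: "chains_in S = chains_in (S - {x}) \<union> insert x ` chains_in ?L"
  proof (intro equalityI subsetI)
    fix C assume C: "C \<in> chains_in S"
    show "C \<in> chains_in (S - {x}) \<union> insert x ` chains_in ?L"
    proof (cases "x \<in> C")
      case True
      then have "x < y \<or> y < x" if "y \<in> C - {x}" for y
        using C that unfolding chains_in_def chain_def by (auto simp: less_le)
      then have "C - {x} \<in> chains_in ?L"
        using C by (auto simp: chains_in_def chain_def)
      then show ?thesis
        using insert_Diff[OF True] by (intro UnI2 image_eqI[of _ _ "C - {x}"]) simp_all
    qed (use C in \<open>auto simp: chains_in_def\<close>)
  next
    fix C assume "C \<in> chains_in (S - {x}) \<union> insert x ` chains_in ?L"
    then show "C \<in> chains_in S"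
    proof
      assume "C \<in> insert x ` chains_in ?L"
      then obtain D where D: "C = insert x D" "D \<subseteq> ?L" "Complete_Partial_Order.chain (\<le>) D"
        by (auto simp: chains_in_def)
      then have "x \<le> y \<or> y \<le> x" if "y \<in> D" for y
        using that by (auto simp: less_le)
      then show ?thesis
        using assms(2) D by (auto simp: chains_in_def chain_def)
    qed (auto simp: chains_in_def)
  qed
  have disj: "chains_in (S - {x}) \<inter> insert x ` chains_in ?L = {}"
    by (auto simp: chains_in_def)
  have inj: "inj_on (insert x) (chains_in ?L)"
    by (rule inj_onI) (auto simp: chains_in_def insert_ident)
  have card: "card (insert x C) = Suc (card C)" if "C \<in> chains_in ?L" for C
    using that assms(1) by (subst card_insert_disjoint) (auto simp: chains_in_def intro: finite_subset)
  have "alt_chain_sum S = alt_chain_sum (S - {x}) + (\<Sum>C\<in>insert x ` chains_in ?L. (- 1) ^ card C)"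
    unfolding alt_chain_sum_def split using assms disj
    by (intro sum.union_disjoint) (auto intro!: finite_imageI finite_chains_in)
  also have "(\<Sum>C\<in>insert x ` chains_in ?L. (- 1) ^ card C) = - alt_chain_sum ?L"
    by (simp add: sum.reindex[OF inj] card alt_chain_sum_def sum_negf)
  finally show ?thesis by simp
qed

text \<open>
  The link of the apex \<open>z\<close> is everything else, so the chains with and without \<open>z\<close> cancel.
\<close>

lemma alt_chain_sum_cone:
  assumes "finite S" "z \<in> S" "\<And>y. y \<in> S \<Longrightarrow> y \<le> z \<or> z \<le> y"
  shows "alt_chain_sum S = 0"
proof -
  have "{y \<in> S. z < y \<or> y < z} = S - {z}"
    using assms(3) by (auto simp: less_le)
  with alt_chain_sum_remove[OF assms(1,2)] show ?thesis by simp
qed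

text \<open>
  A point \<open>x\<close> whose link is a cone (with apex \<open>z\<close>) can be deleted. Only comparability
  matters here, so the criterion serves deletions that proceed upwards as well as
  deletions that proceed downwards, as in the next two lemmas.
\<close>

lemma alt_chain_sum_dismantle:
  assumes "finite S" "T \<subseteq> S"
    and step: "\<And>U. T \<subset> U \<Longrightarrow> U \<subseteq> S \<Longrightarrow>
      \<exists>x\<in>U - T. \<exists>z\<in>U. (z < x \<or> x < z) \<and> (\<forall>y\<in>U. y < x \<or> x < y \<longrightarrow> y \<le> z \<or> z \<le> y)"
  shows "alt_chain_sum S = alt_chain_sum T"
proof -
  have "alt_chain_sum U = alt_chain_sum T" if "T \<subseteq> U" "U \<subseteq> S" for U
    using that
  proof (induction "card U" arbitrary: U rule: less_induct)
    case less
    have fin: "finite U" using less.prems(2) assms(1) by (rule finite_subset)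
    show ?case
    proof (cases "T = U")
      case False
      then obtain x z where x: "x \<in> U - T" and z: "z \<in> U" "z < x \<or> x < z"
        and comp: "\<forall>y\<in>U. y < x \<or> x < y \<longrightarrow> y \<le> z \<or> z \<le> y"
        using step[of U] less.prems by blast
      have "alt_chain_sum {y \<in> U. x < y \<or> y < x} = 0"
        using fin z comp by (intro alt_chain_sum_cone[of _ z]) auto
      then have "alt_chain_sum U = alt_chain_sum (U - {x})"
        using alt_chain_sum_remove[OF fin, of x] x by auto
      also have "\<dots> = alt_chain_sum T"
        using less.prems x card_Diff1_less[OF fin, of x] by (intro less.hyps) auto
      finally show ?thesis .
    qed simp
  qed
  then show ?thesis using assms(2) by blast
qed

text \<open>
  Delete the elements outside \<open>T\<close> from the bottom. When \<open>x\<close> is minimal among those left,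
  everything below \<open>x\<close> is in \<open>T\<close>, hence below \<open>r x\<close>, while everything above \<open>x\<close> is
  above \<open>r x\<close>: the link of \<open>x\<close> is a cone with apex \<open>r x\<close>.
\<close>

lemma alt_chain_sum_coreflective:
  assumes "finite S" "T \<subseteq> S"
    and r: "\<And>x. x \<in> S \<Longrightarrow> r x \<in> T" "\<And>x. x \<in> S \<Longrightarrow> r x \<le> x"
      "\<And>x t. x \<in> S \<Longrightarrow> t \<in> T \<Longrightarrow> t \<le> x \<Longrightarrow> t \<le> r x"
  shows "alt_chain_sum S = alt_chain_sum T"
proof (rule alt_chain_sum_dismantle[OF assms(1,2)])
  fix U assume U: "T \<subset> U" "U \<subseteq> S"
  then have "finite (U - T)" "U - T \<noteq> {}"
    using finite_subset[OF _ assms(1)] by blast+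
  from finite_has_minimal[OF this]
  obtain x where x: "x \<in> U - T" and min: "\<forall>y\<in>U - T. y \<le> x \<longrightarrow> x = y"
    by blast
  have "x \<in> S" using x U by auto
  then have "r x < x" using r(1,2)[of x] x by (auto simp: less_le)
  moreover have "y \<le> r x \<or> r x \<le> y" if y: "y \<in> U" "y < x \<or> x < y" for y
  proof (cases "y < x")
    case True
    then have "y \<in> T" using min y by (metis DiffI less_le)
    then show ?thesis using r(3)[OF \<open>x \<in> S\<close>] True by auto
  next
    case False
    then show ?thesis using y r(2)[OF \<open>x \<in> S\<close>] by auto
  qed
  ultimately show "\<exists>x\<in>U - T. \<exists>z\<in>U. (z < x \<or> x < z) \<and> (\<forall>y\<in>U. y < x \<or> x < y \<longrightarrow> y \<le> z \<or> z \<le> y)"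
    using x r(1)[OF \<open>x \<in> S\<close>] U(1) by blast
qed

text \<open>
  Quillen's contraction \<open>x \<le> j x \<ge> c\<close>, for \<open>j x\<close> the join of \<open>x\<close> and \<open>c\<close>. The elements not
  above \<open>c\<close> are deleted from the top, the link of such an \<open>x\<close> having apex \<open>j x\<close>; then \<open>c\<close>
  is the least element of what remains.
\<close>

lemma alt_chain_sum_conically_contractible:
  assumes "finite S" "c \<in> S"
    and j: "\<And>x. x \<in> S \<Longrightarrow> j x \<in> S" "\<And>x. x \<in> S \<Longrightarrow> x \<le> j x" "\<And>x. x \<in> S \<Longrightarrow> c \<le> j x"
      "\<And>x y. x \<in> S \<Longrightarrow> y \<in> S \<Longrightarrow> x \<le> y \<Longrightarrow> c \<le> y \<Longrightarrow> j x \<le> y"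
  shows "alt_chain_sum S = 0"
proof -
  let ?T = "{y \<in> S. c \<le> y}"
  have "alt_chain_sum S = alt_chain_sum ?T"
  proof (rule alt_chain_sum_dismantle[OF assms(1)])
    fix U assume U: "?T \<subset> U" "U \<subseteq> S"
    then have "finite (U - ?T)" "U - ?T \<noteq> {}"
      using finite_subset[OF _ assms(1)] by blast+
    from finite_has_maximal[OF this]
    obtain x where x: "x \<in> U - ?T" and max: "\<forall>y\<in>U - ?T. x \<le> y \<longrightarrow> x = y"
      by blast
    have S: "x \<in> S" using x U by auto
    then have "x < j x" using j(2,3)[of x] x by (auto simp: less_le)
    moreover have "y \<le> j x \<or> j x \<le> y" if y: "y \<in> U" "y < x \<or> x < y" for y
    proof (cases "x < y")
      case True
      then have "y \<in> ?T" using max y by (metis DiffI less_le)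
      then show ?thesis using j(4)[OF S, of y] True by auto
    next
      case False
      then show ?thesis using y j(2)[OF S] by auto
    qed
    moreover have "j x \<in> U" using j(1,3)[OF S] U(1) by blast
    ultimately show "\<exists>x\<in>U - ?T. \<exists>z\<in>U. (z < x \<or> x < z) \<and> (\<forall>y\<in>U. y < x \<or> x < y \<longrightarrow> y \<le> z \<or> z \<le> y)"
      using x by blast
  qed auto
  also have "\<dots> = 0"
    using assms(1,2) by (intro alt_chain_sum_cone[of _ c]) auto
  finally show ?thesis .
qed

text \<open>
  A nonempty chain consists of its least element \<open>x\<close> and a chain above \<open>x\<close>, so the sum
  over \<open>x\<close> counts the nonempty chains with the opposite sign, and only the empty chain
  survives. The induction deletes a minimal element.
\<close>

lemma alt_chain_sum_sum_upper_intervals: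
  assumes "finite S"
  shows "alt_chain_sum S + (\<Sum>x\<in>S. alt_chain_sum {y \<in> S. x < y}) = 1"
  using assms
proof (induction "card S" arbitrary: S rule: less_induct)
  case less
  show ?case
  proof (cases "S = {}")
    case False
    then obtain x where x: "x \<in> S" and min: "\<And>y. y \<in> S \<Longrightarrow> y \<le> x \<Longrightarrow> x = y"
      using finite_has_minimal[OF less.prems] by auto
    have "{y \<in> S. x < y \<or> y < x} = {y \<in> S. x < y}"
      using min by fastforce
    then have 1: "alt_chain_sum S = alt_chain_sum (S - {x}) - alt_chain_sum {y \<in> S. x < y}"
      using alt_chain_sum_remove[OF less.prems x] by simp
    have "(\<Sum>z\<in>S. alt_chain_sum {y \<in> S. z < y})
        = alt_chain_sum {y \<in> S. x < y} + (\<Sum>z\<in>S - {x}. alt_chain_sum {y \<in> S. z < y})"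
      using less.prems x by (simp add: sum.remove)
    also have "(\<Sum>z\<in>S - {x}. alt_chain_sum {y \<in> S. z < y})
        = (\<Sum>z\<in>S - {x}. alt_chain_sum {y \<in> S - {x}. z < y})"
    proof (rule sum.cong[OF refl])
      fix z assume "z \<in> S - {x}"
      then have "{y \<in> S. z < y} = {y \<in> S - {x}. z < y}"
        using min[of z] by (auto simp: less_le)
      then show "alt_chain_sum {y \<in> S. z < y} = alt_chain_sum {y \<in> S - {x}. z < y}" by simp
    qed
    finally show ?thesis
      using 1 less.hyps[of "S - {x}"] card_Diff1_less[OF less.prems x] less.prems by simp
  qed simp
qed

text \<open>
  In other words, the numbers \<open>alt_chain_sum {z \<in> S. y < z}\<close> are weights whose total over
  every principal upper set is 1. They are the negatives of the values \<open>\<mu>(y, \<top>)\<close> of the Moebius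
  function of \<open>S\<close> with a top element adjoined.
\<close>

lemma sum_upper_intervals_above:
  assumes "finite S" "x \<in> S"
  shows "(\<Sum>y | y \<in> S \<and> x \<le> y. alt_chain_sum {z \<in> S. y < z}) = 1"
proof -
  have eq: "{y \<in> S. x \<le> y} = insert x {y \<in> S. x < y}"
    using assms(2) by (auto simp: less_le)
  have "{z \<in> {y \<in> S. x < y}. y < z} = {z \<in> S. y < z}" if "x < y" for y
    using that by (auto intro: less_trans)
  then have "(\<Sum>y | y \<in> S \<and> x < y. alt_chain_sum {z \<in> {y \<in> S. x < y}. y < z})
      = (\<Sum>y | y \<in> S \<and> x < y. alt_chain_sum {z \<in> S. y < z})"
    by (intro sum.cong) auto
  then show ?thesis
    using alt_chain_sum_sum_upper_intervals[of "{y \<in> S. x < y}"] assms(1) by (simp add: eq)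
qed

lemma alt_chain_sum_iso:
  assumes bij: "bij_betw f S T"
    and mono: "\<And>x y. x \<in> S \<Longrightarrow> y \<in> S \<Longrightarrow> f x \<le> f y \<longleftrightarrow> x \<le> y"
  shows "alt_chain_sum S = alt_chain_sum T"
proof -
  have inj: "inj_on f S" and T: "T = f ` S" using bij by (auto simp: bij_betw_def)
  have "chains_in T = (`) f ` chains_in S"
  proof (intro equalityI subsetI)
    fix D assume D: "D \<in> chains_in T"
    then have "D \<subseteq> f ` S" by (auto simp: chains_in_def T)
    then obtain C where C: "C \<subseteq> S" "D = f ` C" by (auto simp: subset_image_iff)
    have "x \<le> y \<or> y \<le> x" if "x \<in> C" "y \<in> C" for x y
      using D C that mono[of x y] mono[of y x] by (auto simp: chains_in_def chain_def subset_iff)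
    then show "D \<in> (`) f ` chains_in S" using C by (auto simp: chains_in_def chain_def)
  next
    fix D assume "D \<in> (`) f ` chains_in S"
    then obtain C where C: "C \<subseteq> S" "Complete_Partial_Order.chain (\<le>) C" "D = f ` C"
      by (auto simp: chains_in_def)
    then show "D \<in> chains_in T"
      using mono by (auto simp: chains_in_def chain_def T subset_iff)
  qed
  moreover have "inj_on ((`) f) (chains_in S)"
    using inj by (intro inj_on_subset[OF inj_on_image_Pow]) (auto simp: chains_in_def)
  ultimately have "alt_chain_sum T = (\<Sum>C\<in>chains_in S. (- 1) ^ card (f ` C))"
    by (simp add: alt_chain_sum_def sum.reindex)
  also have "\<dots> = alt_chain_sum S" unfolding alt_chain_sum_def
    using inj by (intro sum.cong refl) (auto simp: chains_in_def card_image inj_on_subset)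
  finally show ?thesis by simp
qed

text \<open>
  The defining equations are triangular and can be solved from the bottom upwards. For
  the nontrivial subgroups of a \<open>p\<close>-group, the weights express the property of a subgroup to
  be nontrivial as a weighted sum over its nontrivial subgroups.
\<close>

lemma moebius_weights_exist:
  fixes T :: "'a::order set"
  assumes "finite T"
  shows "\<exists>m :: 'a \<Rightarrow> int. \<forall>x\<in>T. (\<Sum>y | y \<in> T \<and> y \<le> x. m y) = 1"
  using assms
proof (induction "card T" arbitrary: T rule: less_induct)
  case less
  show ?case
  proof (cases "T = {}")
    case False
    then obtain x where x: "x \<in> T" and max: "\<And>y. y \<in> T \<Longrightarrow> x \<le> y \<Longrightarrow> x = y"
      using finite_has_maximal[OF less.prems] by auto
    obtain m :: "'a \<Rightarrow> int" where m: "\<forall>z\<in>T - {x}. (\<Sum>y | y \<in> T - {x} \<and> y \<le> z. m y) = 1"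
      using less.hyps[of "T - {x}"] card_Diff1_less[OF less.prems x] less.prems by auto
    \<comment> \<open>As \<open>x\<close> is maximal, its weight enters only its own equation.\<close>
    let ?m = "m(x := 1 - (\<Sum>y | y \<in> T - {x} \<and> y \<le> x. m y))"
    have "(\<Sum>y | y \<in> T \<and> y \<le> z. ?m y) = 1" if z: "z \<in> T" for z
    proof (cases "z = x")
      case True
      have "{y \<in> T. y \<le> x} = insert x {y. y \<in> T - {x} \<and> y \<le> x}" using x by auto
      moreover have "(\<Sum>y | y \<in> T - {x} \<and> y \<le> x. ?m y) = (\<Sum>y | y \<in> T - {x} \<and> y \<le> x. m y)"
        by (intro sum.cong) auto
      ultimately show ?thesis using True less.prems by simp
    next
      case False
      then have "{y \<in> T. y \<le> z} = {y. y \<in> T - {x} \<and> y \<le> z}" using max[OF z] by auto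
      moreover have "(\<Sum>y | y \<in> T - {x} \<and> y \<le> z. ?m y) = (\<Sum>y | y \<in> T - {x} \<and> y \<le> z. m y)"
        by (intro sum.cong) auto
      ultimately show ?thesis using m z False by simp
    qed
    then show ?thesis by blast
  qed simp
qed

section \<open>Actions of \<open>p\<close>-groups and products of \<open>p\<close>-subgroups\<close>

text \<open>
  Since \<open>f\<close> is constant on orbits, the sum over the orbit of \<open>x\<close> is its size times \<open>f x\<close>.
\<close>

lemma (in group_action) dvd_sum_of_dvd_orbit_sums:
  fixes f :: "'c \<Rightarrow> int"
  assumes "finite E"
    and dvd: "\<And>x. x \<in> E \<Longrightarrow> d dvd int (card (orbit G \<phi> x)) * f x"
    and inv: "\<And>g x. g \<in> carrier G \<Longrightarrow> x \<in> E \<Longrightarrow> f (\<phi> g x) = f x"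
  shows "d dvd (\<Sum>x\<in>E. f x)"
proof -
  have "d dvd (\<Sum>x\<in>B. f x)" if B: "B \<in> orbits G E \<phi>" for B
  proof -
    obtain x where x: "x \<in> E" "B = orbit G \<phi> x"
      using B by (auto simp: orbits_def)
    have "(\<Sum>y\<in>B. f y) = (\<Sum>y\<in>B. f x)"
      using x inv by (intro sum.cong) (auto simp: orbit_def)
    then show ?thesis using dvd[OF x(1)] x(2) by simp
  qed
  then show ?thesis
    using dvd_sum[of "orbits G E \<phi>"] disjoint_sum[OF assms(1), of f] by metis
qed

text \<open>
  The size of an orbit is a power of \<open>p\<close>; if it is not divisible by \<open>p\<close>, then the orbit is
  a single fixed point.
\<close>

lemma (in group_action) p_group_dvd_card_moved_points:
  assumes "Factorial_Ring.prime p" "order G = p ^ n" "finite E"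
  shows "p dvd card {x \<in> E. \<exists>g\<in>carrier G. \<phi> g x \<noteq> x}"
proof -
  \<comment> \<open>The indicator of being moved vanishes on the orbits whose size is prime to \<open>p\<close>.\<close>
  let ?f = "\<lambda>x. if \<exists>g\<in>carrier G. \<phi> g x \<noteq> x then 1 else 0 :: int"
  have "int p dvd (\<Sum>x\<in>E. ?f x)"
  proof (rule dvd_sum_of_dvd_orbit_sums[OF assms(3)])
    fix x assume x: "x \<in> E"
    have "card (orbit G \<phi> x) dvd p ^ n"
      using orbit_stabilizer_theorem[OF x] assms(2) by (metis dvd_triv_left)
    then obtain k where k: "card (orbit G \<phi> x) = p ^ k"
      using assms(1) by (auto simp: divides_primepow_nat)
    have "\<phi> g x = x" if "k = 0" "g \<in> carrier G" for g
    proof -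
      have "card (orbit G \<phi> x) = 1" using k that(1) by simp
      then have "\<exists>y. orbit G \<phi> x = {y}" by (simp add: card_1_singleton_iff)
      moreover have "\<phi> g x \<in> orbit G \<phi> x" using that(2) by (auto simp: orbit_def)
      ultimately show ?thesis using orbit_refl[OF x] by auto
    qed
    then show "int p dvd int (card (orbit G \<phi> x)) * ?f x"
      by (cases "k = 0") (auto simp: k)
  next
    fix g x assume g: "g \<in> carrier G" and x: "x \<in> E"
    have "\<phi> g x = x" if "\<forall>h\<in>carrier G. \<phi> h (\<phi> g x) = \<phi> g x"
      using orbit_sym_aux[OF g x refl] that g group_hom
      by (simp add: group_hom_def)
    then show "?f (\<phi> g x) = ?f x"
      using g by (smt (verit, best))
  qed
  also have "(\<Sum>x\<in>E. ?f x) = int (card {x \<in> E. \<exists>g\<in>carrier G. \<phi> g x \<noteq> x})"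
    using assms(3) by (simp add: sum.If_cases Int_def)
  finally show ?thesis by simp
qed

text \<open>
  The restriction to \<open>E\<close> makes the maps extensional, as elements of \<open>BijGroup E\<close> must be.
\<close>

lemma (in group) group_actionI:
  assumes closed: "\<And>g x. g \<in> carrier G \<Longrightarrow> x \<in> E \<Longrightarrow> act g x \<in> E"
    and one: "\<And>x. x \<in> E \<Longrightarrow> act \<one> x = x"
    and mult: "\<And>g h x. g \<in> carrier G \<Longrightarrow> h \<in> carrier G \<Longrightarrow> x \<in> E \<Longrightarrow> act (g \<otimes> h) x = act g (act h x)"
  shows "group_action G E (\<lambda>g. \<lambda>x\<in>E. act g x)"
proof -
  have bij: "(\<lambda>x\<in>E. act g x) \<in> Bij E" if g: "g \<in> carrier G" for g
  proof -
    have "act (inv g) (act g x) = x" "act g (act (inv g) x) = x" if "x \<in> E" for x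
      using mult[of "inv g" g x] mult[of g "inv g" x] g that one by auto
    then have "bij_betw (act g) E E"
      using closed g by (intro bij_betw_byWitness[of E "act (inv g)"]) auto
    then show ?thesis by (auto simp: Bij_def cong: bij_betw_cong)
  qed
  have "(\<lambda>g. \<lambda>x\<in>E. act g x) \<in> hom G (BijGroup E)"
    by (rule homI) (auto simp: BijGroup_def bij compose_def closed mult fun_eq_iff)
  then show ?thesis
    by (simp add: group_action_def group_hom_def group_hom_axioms_def group_BijGroup is_group)
qed

text \<open>
  Let \<open>K\<close> act on its left cosets by left multiplication. Their number is a power of \<open>p\<close>
  greater than 1, so \<open>p\<close> divides the number of fixed cosets. As \<open>K\<close> itself is fixed, there is
  a second fixed coset \<open>x <# K\<close>, and \<open>K <#> (x <# K) = x <# K\<close> says that \<open>inv x\<close> normalizes \<open>K\<close>.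
\<close>

lemma (in group) p_group_normalizer_grows:
  assumes p: "Factorial_Ring.prime p" and ord: "order G = p ^ n"
    and K: "subgroup K G" "K \<noteq> carrier G"
  shows "\<exists>x\<in>carrier G - K. \<forall>k\<in>K. x \<otimes> k \<otimes> inv x \<in> K"
proof -
  have fin: "finite (carrier G)"
    using ord p prime_gt_0_nat by (metis order_gt_0_iff_finite zero_less_power)
  have Ksub: "K \<subseteq> carrier G" using K(1) by (rule subgroup.subset)
  interpret K: group "G\<lparr>carrier := K\<rparr>"
    using K(1) by (rule subgroup_imp_group)
  have coset_in: "D \<subseteq> carrier G" if "D \<in> lcosets K" for D
    using that Ksub by (auto simp: LCOSETS_def l_coset_def)
  have "group_action (G\<lparr>carrier := K\<rparr>) (lcosets K) (\<lambda>k. \<lambda>D\<in>lcosets K. k <# D)"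
  proof (rule K.group_actionI)
    fix k D assume k: "k \<in> carrier (G\<lparr>carrier := K\<rparr>)" and "D \<in> lcosets K"
    then obtain x where "x \<in> carrier G" "D = x <# K" by (auto simp: LCOSETS_def)
    moreover have "k \<in> carrier G" using k Ksub by auto
    ultimately have "k \<otimes> x \<in> carrier G" "k <# D = (k \<otimes> x) <# K"
      using Ksub by (auto simp: lcos_m_assoc)
    then show "k <# D \<in> lcosets K" by (auto simp: LCOSETS_def)
  next
    fix g h D assume "g \<in> carrier (G\<lparr>carrier := K\<rparr>)" "h \<in> carrier (G\<lparr>carrier := K\<rparr>)" "D \<in> lcosets K"
    then have "g \<in> carrier G" "h \<in> carrier G" "D \<subseteq> carrier G" using Ksub coset_in by auto
    then show "g \<otimes>\<^bsub>G\<lparr>carrier := K\<rparr>\<^esub> h <# D = g <# (h <# D)"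
      by (simp add: lcos_m_assoc)
  qed (use coset_in in \<open>auto simp: lcos_mult_one\<close>)
  then interpret act: group_action "G\<lparr>carrier := K\<rparr>" "lcosets K" "\<lambda>k. \<lambda>D\<in>lcosets K. k <# D" .
  have lagr: "card (lcosets K) * card K = p ^ n"
    using l_lagrange[OF fin K(1)] ord by simp
  then have "card K dvd p ^ n" "card (lcosets K) dvd p ^ n" by (metis dvd_triv_left dvd_triv_right)+
  then obtain a b where ab: "card K = p ^ a" "card (lcosets K) = p ^ b"
    using p by (auto simp: divides_primepow_nat)
  have finE: "finite (lcosets K)" using lagr p
    by (metis card.infinite mult_0 not_prime_0 power_not_zero)
  have "b \<noteq> 0"
  proof
    assume "b = 0"
    then have "card K = card (carrier G)" using lagr ab ord by (simp add: order_def)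
    then show False using K(2) Ksub fin by (metis card_subset_eq)
  qed
  then have p_dvd: "p dvd card (lcosets K)" using ab(2) by simp
  let ?M = "{D \<in> lcosets K. \<exists>k\<in>K. k <# D \<noteq> D}" and ?F = "{D \<in> lcosets K. \<forall>k\<in>K. k <# D = D}"
  have "?M = {D \<in> lcosets K. \<exists>k\<in>carrier (G\<lparr>carrier := K\<rparr>). (\<lambda>D\<in>lcosets K. k <# D) D \<noteq> D}"
    by auto
  then have M_dvd: "p dvd card ?M"
    using act.p_group_dvd_card_moved_points[OF p _ finE, of a] ab(1) by (simp add: order_def)
  have "card (lcosets K) = card ?F + card ?M"
    using finE by (subst card_Un_disjoint[symmetric]) (auto intro: arg_cong[of _ _ card])
  with p_dvd have "p dvd card ?F + card ?M" by (rule subst[rotated])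
  then have F_dvd: "p dvd card ?F" using dvd_add_left_iff[OF M_dvd, of "card ?F"] by (rule iffD1[rotated])
  have KF: "K \<in> ?F"
  proof -
    have "K = \<one> <# K" using Ksub by (simp add: lcos_mult_one)
    then have "K \<in> lcosets K" by (auto simp: LCOSETS_def)
    then show ?thesis using coset_join3[OF _ K(1)] Ksub by auto
  qed
  have "card ?F > 0"
    using KF finE by (subst card_gt_0_iff) auto
  then have "card ?F > 1"
    using F_dvd dvd_imp_le[of p "card ?F"] prime_gt_1_nat[OF p] by linarith
  then have "?F \<noteq> {K}" by force
  then obtain D where D: "D \<in> lcosets K" "\<forall>k\<in>K. k <# D = D" "D \<noteq> K" using KF by blast
  then obtain x where x: "x \<in> carrier G" "D = x <# K" by (auto simp: LCOSETS_def)
  have "inv x \<otimes> k \<otimes> x \<in> K" if k: "k \<in> K" for k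
  proof -
    have "x = x \<otimes> \<one>" using x by simp
    then have "x \<in> D" using subgroup.one_closed[OF K(1)] by (auto simp: x(2) l_coset_def)
    then have "k \<otimes> x \<in> D" using D(2) k by (force simp: l_coset_def)
    then obtain h where h: "h \<in> K" "k \<otimes> x = x \<otimes> h" by (auto simp: x(2) l_coset_def)
    have in_G: "k \<in> carrier G" "h \<in> carrier G" using k h(1) Ksub by auto
    have "inv x \<otimes> k \<otimes> x = inv x \<otimes> (x \<otimes> h)" using x(1) in_G h(2) by (simp add: m_assoc)
    also have "\<dots> = h" using x(1) in_G by (simp add: m_assoc[symmetric])
    finally show ?thesis using \<open>h \<in> K\<close> by simp
  qed
  moreover have "inv x \<notin> K"
  proof
    assume "inv x \<in> K"
    then have "x \<in> K" using subgroup.m_inv_closed[OF K(1), of "inv x"] x(1) by simp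
    then show False using coset_join3[OF x(1) K(1)] D(3) x(2) by simp
  qed
  ultimately show ?thesis using x(1) by (intro bexI[of _ "inv x"]) auto
qed

lemma (in group) conjugate_eq_image: "x <# K #> inv x = (\<lambda>k. x \<otimes> k \<otimes> inv x) ` K"
  by (auto simp: l_coset_def r_coset_def)

lemma (in group) card_conjugate:
  assumes "x \<in> carrier G" "K \<subseteq> carrier G"
  shows "card (x <# K #> inv x) = card K"
proof -
  have "inj_on (\<lambda>k. x \<otimes> k \<otimes> inv x) K"
    using assms by (intro inj_onI) (metis conjugation_is_inj subsetD)
  then show ?thesis by (simp add: conjugate_eq_image card_image)
qed

lemma (in group) mem_normalizer_conj:
  assumes "K \<subseteq> carrier G"
  shows "x \<in> normalizer G K \<longleftrightarrow> x \<in> carrier G \<and> x <# K #> inv x = K"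
  using assms by (auto simp: normalizer_def stabilizer_def)

lemma (in group) subgroup_le_normalizer:
  assumes "subgroup L G"
  shows "L \<subseteq> normalizer G L"
  using subgroup_in_normalizer[OF assms] by (auto dest!: normal_imp_subgroup subgroup.subset)

text \<open>
  In a finite group, a conjugate of \<open>K\<close> inside \<open>K\<close> is equal to \<open>K\<close>.
\<close>

lemma (in group) mem_normalizer_iff:
  assumes "finite (carrier G)" "K \<subseteq> carrier G"
  shows "x \<in> normalizer G K \<longleftrightarrow> x \<in> carrier G \<and> (\<forall>k\<in>K. x \<otimes> k \<otimes> inv x \<in> K)"
proof -
  have "x <# K #> inv x = K" if "x \<in> carrier G" "x <# K #> inv x \<subseteq> K"
    using card_subset_eq[OF _ that(2)] card_conjugate[OF that(1) assms(2)]
      finite_subset[OF assms(2,1)] by simp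
  then show ?thesis
    unfolding mem_normalizer_conj[OF assms(2)] by (auto simp: conjugate_eq_image)
qed

lemma (in group) p_subgroup_mono:
  assumes "Factorial_Ring.prime p" "p_subgroup p L G" "subgroup K G" "K \<subseteq> L"
  shows "p_subgroup p K G"
proof -
  obtain n where L: "subgroup L G" "card L = p ^ n"
    using assms(2) by (auto simp: p_subgroup_def)
  have "subgroup K (G\<lparr>carrier := L\<rparr>)"
    using assms(3,4) L(1) subgroup_incl by blast
  from group.lagrange[OF subgroup_imp_group[OF L(1)] this]
  have "card K dvd card L"
    by (simp add: order_def) (metis dvd_triv_right)
  then show ?thesis
    using L(2) assms(1,3) by (auto simp: p_subgroup_def divides_primepow_nat)
qed

text \<open>
  By the second isomorphism theorem in the normalizer of \<open>K\<close>, the order of \<open>K <#> L\<close> is the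
  order of \<open>K\<close> times the index of \<open>K \<inter> L\<close> in \<open>L\<close>.
\<close>

lemma (in group) p_subgroup_set_mult:
  assumes p: "Factorial_Ring.prime p" and fin: "finite (carrier G)"
    and K: "p_subgroup p K G" and L: "p_subgroup p L G"
    and norm: "\<And>x k. x \<in> L \<Longrightarrow> k \<in> K \<Longrightarrow> x \<otimes> k \<otimes> inv x \<in> K"
  shows "p_subgroup p (K <#> L) G" "K \<subseteq> K <#> L" "L \<subseteq> K <#> L"
proof -
  have sK: "subgroup K G" and sL: "subgroup L G"
    using K L by (auto simp: p_subgroup_def)
  let ?N = "G\<lparr>carrier := normalizer G K\<rparr>"
  have sN: "subgroup (normalizer G K) G"
    using sK subgroup.subset normalizer_imp_subgroup by blast
  have "L \<subseteq> normalizer G K"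
    using mem_normalizer_iff[OF fin subgroup.subset[OF sK]] norm subgroup.subset[OF sL] by auto
  then have LN: "subgroup L ?N"
    using sL sN subgroup_incl by blast
  interpret N: second_isomorphism_grp K ?N L
    using subgroup_in_normalizer[OF sK] LN
    by (simp add: second_isomorphism_grp_def second_isomorphism_grp_axioms_def)
  show "K \<subseteq> K <#> L" "L \<subseteq> K <#> L"
    using N.H_contained_in_set_mult N.S_contained_in_set_mult by simp_all
  have sKL: "subgroup (K <#> L) G"
    using N.normal_set_mult_subgroup incl_subgroup[OF sN] by simp
  have "\<exists>h. h \<in> iso ((?N\<lparr>carrier := L\<rparr>) Mod (K \<inter> L)) (?N\<lparr>carrier := K <#> L\<rparr> Mod K)"
    using N.normal_intersection_quotient_isom by auto
  then have quot: "card (rcosets\<^bsub>G\<lparr>carrier := L\<rparr>\<^esub> (K \<inter> L)) = card (rcosets\<^bsub>G\<lparr>carrier := K <#> L\<rparr>\<^esub> K)"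
    by (auto simp: iso_def FactGroup_def intro: bij_betw_same_card)
  have "subgroup (K \<inter> L) (G\<lparr>carrier := L\<rparr>)"
    using subgroups_Inter_pair[OF sK sL] sL subgroup_incl by blast
  from group.lagrange[OF subgroup_imp_group[OF sL] this]
  have 1: "card (rcosets\<^bsub>G\<lparr>carrier := L\<rparr>\<^esub> (K \<inter> L)) dvd card L"
    by (simp add: order_def) (metis dvd_triv_left)
  have "subgroup K (G\<lparr>carrier := K <#> L\<rparr>)"
    using sK sKL \<open>K \<subseteq> K <#> L\<close> subgroup_incl by blast
  from group.lagrange[OF subgroup_imp_group[OF sKL] this]
  have 2: "card (rcosets\<^bsub>G\<lparr>carrier := K <#> L\<rparr>\<^esub> K) * card K = card (K <#> L)"
    by (simp add: order_def)
  obtain a b where "card K = p ^ a" "card L = p ^ b"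
    using K L by (auto simp: p_subgroup_def)
  with 1 2 quot have "card (K <#> L) dvd p ^ b * p ^ a"
    by (metis dvd_refl mult_dvd_mono)
  then have "card (K <#> L) dvd p ^ (b + a)" by (simp add: power_add)
  then show "p_subgroup p (K <#> L) G"
    using sKL p by (auto simp: p_subgroup_def divides_primepow_nat)
qed

text \<open>
  The product of two normal \<open>p\<close>-subgroups is again one, so a maximal normal \<open>p\<close>-subgroup
  contains all the others.
\<close>

lemma (in group) p_core_greatest:
  assumes p: "Factorial_Ring.prime p" and fin: "finite (carrier G)"
  shows "p_core p G \<lhd> G" "p_subgroup p (p_core p G) G"
    and "\<And>Q. Q \<lhd> G \<Longrightarrow> p_subgroup p Q G \<Longrightarrow> Q \<subseteq> p_core p G"
proof -
  let ?F = "{P. P \<lhd> G \<and> p_subgroup p P G}"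
  have "?F \<subseteq> Pow (carrier G)" by (auto simp: p_subgroup_def dest: subgroup.subset)
  then have "finite ?F" using fin by (metis finite_Pow_iff finite_subset)
  moreover have "{\<one>} \<in> ?F"
    using one_is_normal triv_subgroup by (auto simp: p_subgroup_def intro: exI[of _ 0])
  then have "?F \<noteq> {}" by blast
  ultimately obtain M where M: "M \<in> ?F" and max: "\<forall>P\<in>?F. M \<subseteq> P \<longrightarrow> M = P"
    by (rule finite_has_maximal[THEN bexE])
  have great: "Q \<subseteq> M" if Q: "Q \<lhd> G" "p_subgroup p Q G" for Q
  proof -
    have norm: "x \<otimes> k \<otimes> inv x \<in> M" if "x \<in> Q" "k \<in> M" for x k
      using normal.inv_op_closed2[of M G x k] M that Q(2) subgroup.subset[of Q G]
      by (auto simp: p_subgroup_def)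
    note prod = p_subgroup_set_mult[OF p fin _ Q(2) norm]
    have "M <#> Q \<in> ?F"
      using prod(1) M Q(1) normal_subgroup_set_mult_closed by auto
    then have "M = M <#> Q" using max prod(2) M by auto
    then show ?thesis using prod(3) M by auto
  qed
  have "p_core p G = M"
    unfolding p_core_def using M great by (intro Greatest_equality) auto
  then show "p_core p G \<lhd> G" "p_subgroup p (p_core p G) G"
    and "\<And>Q. Q \<lhd> G \<Longrightarrow> p_subgroup p Q G \<Longrightarrow> Q \<subseteq> p_core p G"
    using M great by auto
qed

section \<open>Invariant \<open>p\<close>-subgroups of a group with operators\<close>

locale group_with_operators = group G for G (structure) +
  fixes A :: "('c, 'd) monoid_scheme" and \<phi> :: "'c \<Rightarrow> 'a \<Rightarrow> 'a" and p :: nat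
  assumes finite_carrier: "finite (carrier G)"
    and action: "\<phi> \<in> hom A (AutoGroup G)"
    and prime_p: "Factorial_Ring.prime p"
begin

lemma act_hom: "a \<in> carrier A \<Longrightarrow> \<phi> a \<in> hom G G"
  and act_bij: "a \<in> carrier A \<Longrightarrow> bij_betw (\<phi> a) (carrier G) (carrier G)"
  using hom_in_carrier[OF action] by (auto simp: AutoGroup_def auto_def Bij_def)

lemma act_inj: "a \<in> carrier A \<Longrightarrow> inj_on (\<phi> a) (carrier G)"
  using act_bij by (auto simp: bij_betw_def)

text \<open>
  The automorphisms are injective and \<open>H\<close> is finite, so inclusion implies equality.
\<close>

lemma normalized_by_iff:
  assumes "H \<subseteq> carrier G"
  shows "normalized_by A \<phi> H \<longleftrightarrow> (\<forall>a\<in>carrier A. \<phi> a ` H \<subseteq> H)"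
proof -
  have "\<phi> a ` H = H" if "a \<in> carrier A" "\<phi> a ` H \<subseteq> H" for a
  proof (rule card_subset_eq[OF _ that(2)])
    show "finite H" using assms finite_carrier by (rule finite_subset)
    show "card (\<phi> a ` H) = card H"
      using act_inj[OF that(1)] assms by (intro card_image) (rule inj_on_subset)
  qed
  then show ?thesis by (auto simp: normalized_by_def)
qed

lemma fixed_points_subgroup: "subgroup (fixed_points A \<phi> (carrier G)) G"
proof (rule subgroupI)
  have one: "\<phi> a \<one> = \<one>" if "a \<in> carrier A" for a
    using act_hom[OF that] hom_one is_group by blast
  then show "fixed_points A \<phi> (carrier G) \<noteq> {}"
    by (auto simp: fixed_points_def)
  fix x assume x: "x \<in> fixed_points A \<phi> (carrier G)"
  have "\<phi> a (inv x) = inv x" if "a \<in> carrier A" for a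
  proof -
    interpret a: group_hom G G "\<phi> a"
      using act_hom[OF that] by (simp add: group_hom_def group_hom_axioms_def is_group)
    show ?thesis using x that by (simp add: fixed_points_def)
  qed
  then show "inv x \<in> fixed_points A \<phi> (carrier G)"
    using x by (auto simp: fixed_points_def)
next
  fix x y assume "x \<in> fixed_points A \<phi> (carrier G)" "y \<in> fixed_points A \<phi> (carrier G)"
  then show "x \<otimes> y \<in> fixed_points A \<phi> (carrier G)"
    by (auto simp: fixed_points_def hom_mult[OF act_hom])
qed (auto simp: fixed_points_def)

lemma normalized_by_if_fixed: "Q \<subseteq> fixed_points A \<phi> (carrier G) \<Longrightarrow> normalized_by A \<phi> Q"
  by (subst normalized_by_iff) (auto simp: fixed_points_def)

lemma normalized_by_normalizer:
  assumes H: "H \<subseteq> carrier G" "normalized_by A \<phi> H"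
  shows "normalized_by A \<phi> (normalizer G H)"
proof (subst normalized_by_iff)
  show "normalizer G H \<subseteq> carrier G"
    using normalizer_imp_subgroup[OF H(1)] by (rule subgroup.subset)
  show "\<forall>a\<in>carrier A. \<phi> a ` normalizer G H \<subseteq> normalizer G H"
  proof (intro ballI image_subsetI)
    fix a x assume a: "a \<in> carrier A" and "x \<in> normalizer G H"
    then have x: "x \<in> carrier G" "x <# H #> inv x = H"
      using mem_normalizer_conj[OF H(1)] by auto
    interpret a: group_hom G G "\<phi> a"
      using act_hom[OF a] by (simp add: group_hom_def group_hom_axioms_def is_group)
    have "\<phi> a ` (x <# H #> inv x) = \<phi> a x <# \<phi> a ` H #> inv (\<phi> a x)"
      using x(1) H(1) by (simp add: coset_hom[OF a.homh] l_coset_subset_G)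
    then show "\<phi> a x \<in> normalizer G H"
      using mem_normalizer_conj[OF H(1)] H(2) a x by (simp add: normalized_by_def)
  qed
qed

lemma normalized_by_set_mult:
  assumes "H \<subseteq> carrier G" "normalized_by A \<phi> H" "L \<subseteq> carrier G" "normalized_by A \<phi> L"
  shows "normalized_by A \<phi> (H <#> L)"
  using assms by (auto simp: normalized_by_def set_mult_hom[OF act_hom])

definition invariant_p_subgroups :: "'a set set"
  where "invariant_p_subgroups = {L. p_subgroup p L G \<and> normalized_by A \<phi> L}"

lemma invariant_p_subgroupsD:
  assumes "L \<in> invariant_p_subgroups"
  shows "p_subgroup p L G" "normalized_by A \<phi> L" "subgroup L G" "L \<subseteq> carrier G"
  using assms by (auto simp: invariant_p_subgroups_def p_subgroup_def dest: subgroup.subset)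

lemma finite_invariant_p_subgroups: "finite invariant_p_subgroups"
  using finite_carrier invariant_p_subgroupsD(4)
  by (intro finite_subset[of invariant_p_subgroups "Pow (carrier G)"]) auto

text \<open>
  With the next lemma: \<open>K <#> L\<close> is the join of \<open>K\<close> and \<open>L\<close> in the poset.
\<close>

lemma set_mult_invariant_p_subgroups:
  assumes K: "K \<in> invariant_p_subgroups" and L: "L \<in> invariant_p_subgroups"
    and norm: "L \<subseteq> normalizer G K"
  shows "K <#> L \<in> invariant_p_subgroups" "K \<subseteq> K <#> L" "L \<subseteq> K <#> L"
proof -
  have "x \<otimes> k \<otimes> inv x \<in> K" if "x \<in> L" "k \<in> K" for x k
    using mem_normalizer_iff[OF finite_carrier invariant_p_subgroupsD(4)[OF K]] norm that by blast
  note prod = p_subgroup_set_mult[OF prime_p finite_carrier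
      invariant_p_subgroupsD(1)[OF K] invariant_p_subgroupsD(1)[OF L] this]
  show "K <#> L \<in> invariant_p_subgroups"
    using prod(1) normalized_by_set_mult[of K L] invariant_p_subgroupsD[OF K] invariant_p_subgroupsD[OF L]
    by (simp add: invariant_p_subgroups_def)
  show "K \<subseteq> K <#> L" "L \<subseteq> K <#> L"
    using prod(2,3) by auto
qed

lemma set_mult_least:
  assumes "subgroup M G" "K \<subseteq> M" "L \<subseteq> M"
  shows "K <#> L \<subseteq> M"
  using mono_set_mult[OF assms(2,3), of G] subgroup_mult_id[OF assms(1)] by simp

definition above :: "'a set \<Rightarrow> 'a set set"
  where "above K = {L \<in> invariant_p_subgroups. K \<subset> L}"

text \<open>
  These subgroups \<open>L\<close> correspond to the nonidentity invariant \<open>p\<close>-subgroups \<open>L/K\<close> of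
  \<open>N\<^sub>G(K)/K\<close>.
\<close>

definition normally_above :: "'a set \<Rightarrow> 'a set set"
  where "normally_above K = {L \<in> above K. L \<subseteq> normalizer G K}"

lemma finite_above: "finite (above K)" "finite (normally_above K)"
  using finite_invariant_p_subgroups by (auto simp: above_def normally_above_def)

text \<open>
  The largest element of \<open>normally_above K\<close> inside \<open>L\<close> is \<open>N\<^sub>L(K) = L \<inter> N\<^sub>G(K)\<close>; it is
  strictly larger than \<open>K\<close> because normalizers grow in the \<open>p\<close>-group \<open>L\<close>.
\<close>

lemma alt_chain_sum_above_eq_normally_above:
  assumes K: "K \<in> invariant_p_subgroups"
  shows "alt_chain_sum (above K) = alt_chain_sum (normally_above K)"
proof (rule alt_chain_sum_coreflective[where r = "\<lambda>L. L \<inter> normalizer G K"])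
  note K' = invariant_p_subgroupsD[OF K]
  have sN: "subgroup (normalizer G K) G"
    using normalizer_imp_subgroup K'(4) .
  fix L assume "L \<in> above K"
  then have L: "L \<in> invariant_p_subgroups" "K \<subset> L" by (auto simp: above_def)
  note L' = invariant_p_subgroupsD[OF L(1)]
  have sub: "subgroup (L \<inter> normalizer G K) G"
    using subgroups_Inter_pair[OF L'(3) sN] .
  have "normalized_by A \<phi> (L \<inter> normalizer G K)"
  proof (subst normalized_by_iff)
    show "\<forall>a\<in>carrier A. \<phi> a ` (L \<inter> normalizer G K) \<subseteq> L \<inter> normalizer G K"
      using L'(2) normalized_by_normalizer[OF K'(4,2)] image_Int_subset
      unfolding normalized_by_def by metis
  qed (use L'(4) in auto)
  then have 1: "L \<inter> normalizer G K \<in> invariant_p_subgroups"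
    using p_subgroup_mono[OF prime_p L'(1) sub] by (simp add: invariant_p_subgroups_def)
  interpret L: group "G\<lparr>carrier := L\<rparr>"
    using L'(3) by (rule subgroup_imp_group)
  obtain n where "order (G\<lparr>carrier := L\<rparr>) = p ^ n"
    using L'(1) by (auto simp: p_subgroup_def order_def)
  moreover have "subgroup K (G\<lparr>carrier := L\<rparr>)"
    using K'(3) L'(3) L(2) subgroup_incl by blast
  ultimately obtain x where x: "x \<in> L - K"
      "\<forall>k\<in>K. x \<otimes> k \<otimes> inv\<^bsub>G\<lparr>carrier := L\<rparr>\<^esub> x \<in> K"
    using L.p_group_normalizer_grows[OF prime_p, of n K] L(2) by auto
  then have "x \<in> normalizer G K"
    using L'(3,4) by (subst mem_normalizer_iff[OF finite_carrier K'(4)])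
      (auto simp: m_inv_consistent)
  moreover have "K \<subseteq> normalizer G K" using K'(3) by (rule subgroup_le_normalizer)
  ultimately have "K \<subset> L \<inter> normalizer G K" using x(1) L(2) by blast
  then show "L \<inter> normalizer G K \<in> normally_above K"
    using 1 by (auto simp: normally_above_def above_def)
qed (auto simp: finite_above normally_above_def)

text \<open>
  If \<open>K\<close> is not radical, then \<open>Q = O\<^sub>p(N\<^sub>G(K))\<close> is strictly larger than \<open>K\<close>. The automorphisms
  from \<open>A\<close> preserve \<open>N\<^sub>G(K)\<close> and therefore the largest normal \<open>p\<close>-subgroup \<open>Q\<close> of it. So \<open>Q\<close>
  belongs to the poset, and \<open>L \<subseteq> Q <#> L \<supseteq> Q\<close> contracts the poset to a point.
\<close>

lemma alt_chain_sum_normally_above_nonradical: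
  assumes K: "K \<in> invariant_p_subgroups" and nonrad: "\<not> radical_p_subgroup p K G"
  shows "alt_chain_sum (normally_above K) = 0"
proof -
  note K' = invariant_p_subgroupsD[OF K]
  let ?N = "normalizer_group G K" and ?Q = "p_core p (normalizer_group G K)"
  have sN: "subgroup (normalizer G K) G"
    using normalizer_imp_subgroup K'(4) .
  then interpret N: group ?N
    unfolding normalizer_group_def by (rule subgroup_imp_group)
  have carN: "carrier ?N = normalizer G K" by (simp add: normalizer_group_def)
  have NG: "normalizer G K \<subseteq> carrier G" using sN by (rule subgroup.subset)
  have finN: "finite (carrier ?N)"
    using finite_subset[OF NG finite_carrier] by (simp add: carN)
  note core = N.p_core_greatest[OF prime_p finN]
  have QN: "?Q \<subseteq> normalizer G K"
    using core(1) carN by (metis normal_imp_subgroup subgroup.subset)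
  have sQ: "subgroup ?Q G"
    using incl_subgroup[OF sN, of ?Q] core(1) by (simp add: normalizer_group_def normal_imp_subgroup)
  have pQ: "p_subgroup p ?Q G"
    using sQ core(2) by (simp add: p_subgroup_def)
  have "normalized_by A \<phi> ?Q"
  proof (subst normalized_by_iff)
    show "\<forall>a\<in>carrier A. \<phi> a ` ?Q \<subseteq> ?Q"
    proof
      fix a assume a: "a \<in> carrier A"
      have img: "\<phi> a ` normalizer G K = normalizer G K"
        using normalized_by_normalizer[OF K'(4,2)] a by (simp add: normalized_by_def)
      have inj: "inj_on (\<phi> a) (normalizer G K)"
        using act_inj[OF a] NG by (rule inj_on_subset)
      have "\<phi> a ` normalizer G K \<subseteq> normalizer G K" using img by simp
      then have "\<phi> a \<in> iso ?N ?N"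
        using act_hom[OF a] NG img inj
        by (auto simp: iso_def hom_def normalizer_group_def bij_betw_def subset_iff)
      then have norm: "\<phi> a ` ?Q \<lhd> ?N"
        using iso_normal_subgroup N.is_group core(1) by blast
      have "card (\<phi> a ` ?Q) = card ?Q"
        using inj_on_subset[OF inj QN] by (rule card_image)
      then have "p_subgroup p (\<phi> a ` ?Q) ?N"
        using core(2) normal_imp_subgroup[OF norm] by (simp add: p_subgroup_def)
      then show "\<phi> a ` ?Q \<subseteq> ?Q" using core(3) norm by blast
    qed
  qed (use QN NG in auto)
  then have Q: "?Q \<in> invariant_p_subgroups"
    using pQ by (simp add: invariant_p_subgroups_def)
  have "K \<lhd> ?N" "p_subgroup p K ?N"
    using subgroup_in_normalizer[OF K'(3)] K'(1)
    by (auto simp: normalizer_group_def p_subgroup_def dest: normal_imp_subgroup)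
  then have "K \<subseteq> ?Q" using core(3) by blast
  then have KQ: "K \<subset> ?Q"
    using nonrad K'(1) by (auto simp: radical_p_subgroup_def)
  have "normalizer G K \<subseteq> normalizer G ?Q"
  proof
    fix x assume x: "x \<in> normalizer G K"
    then have "x \<otimes> k \<otimes> inv x \<in> ?Q" if "k \<in> ?Q" for k
      using normal.inv_op_closed2[OF core(1), of x k] that
      by (simp add: normalizer_group_def m_inv_consistent[OF sN])
    then show "x \<in> normalizer G ?Q"
      using x NG by (subst mem_normalizer_iff[OF finite_carrier subgroup.subset[OF sQ]]) auto
  qed
  then have prod: "?Q <#> L \<in> invariant_p_subgroups" "?Q \<subseteq> ?Q <#> L" "L \<subseteq> ?Q <#> L"
    if "L \<in> normally_above K" for L
    using set_mult_invariant_p_subgroups[OF Q, of L] that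
    by (auto simp: normally_above_def above_def)
  show ?thesis
  proof (rule alt_chain_sum_conically_contractible[where c = ?Q and j = "\<lambda>L. ?Q <#> L"])
    show "?Q \<in> normally_above K"
      using Q KQ QN by (simp add: normally_above_def above_def)
    fix L assume L: "L \<in> normally_above K"
    then have "?Q <#> L \<subseteq> normalizer G K"
      using set_mult_least[OF sN QN] by (simp add: normally_above_def)
    then show "?Q <#> L \<in> normally_above K"
      using prod[OF L] KQ by (auto simp: normally_above_def above_def)
    show "L \<subseteq> ?Q <#> L" "?Q \<subseteq> ?Q <#> L" using prod[OF L] by auto
  next
    fix L M assume "M \<in> normally_above K" "L \<subseteq> M" "?Q \<subseteq> M"
    moreover from this have "subgroup M G"
      by (auto simp: normally_above_def above_def intro: invariant_p_subgroupsD(3))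
    ultimately show "?Q <#> L \<subseteq> M" using set_mult_least by blast
  qed (rule finite_above)
qed

section \<open>Passage to normalizer quotients\<close>

text \<open>
  The correspondence theorem: \<open>L\<close> is sent to its set of cosets of \<open>K\<close>, and a subgroup of the
  quotient to its union. Both maps are compatible with the action of \<open>A\<close> by taking images.
\<close>

lemma alt_chain_sum_normally_above_eq_quotient:
  assumes K: "K \<in> invariant_p_subgroups"
  shows "alt_chain_sum (normally_above K)
    = - reduced_euler_char
          (normalized_p_poset A (quotient_action G \<phi> K) p (normalizer_quotient G K))"
proof -
  note K' = invariant_p_subgroupsD[OF K]
  let ?N = "normalizer_group G K" and ?Q = "normalizer_quotient G K"
  let ?X = "normalized_p_poset A (quotient_action G \<phi> K) p ?Q"
  let ?f = "\<lambda>L. (\<lambda>x. K #> x) ` L"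
  have sN: "subgroup (normalizer G K) G"
    using normalizer_imp_subgroup K'(4) .
  have NG: "normalizer G K \<subseteq> carrier G" using sN by (rule subgroup.subset)
  interpret N: normal K ?N
    using subgroup_in_normalizer[OF K'(3)] by (simp add: normalizer_group_def)
  have carQ: "carrier ?Q = ?f (normalizer G K)" and oneQ: "\<one>\<^bsub>?Q\<^esub> = K"
    by (auto simp: normalizer_quotient_def FactGroup_def RCOSETS_def normalizer_group_def)
  have f_eq: "?f L = rcosets\<^bsub>?N\<lparr>carrier := L\<rparr>\<^esub> K" for L
    by (auto simp: RCOSETS_def normalizer_group_def)
  have act_coset: "quotient_action G \<phi> K a (K #> x) = K #> \<phi> a x"
    if "a \<in> carrier A" "x \<in> normalizer G K" for a x
    using that K'(2) NG carQ coset_hom(2)[OF act_hom[OF that(1)] K'(4), of x]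
    by (auto simp: quotient_action_def normalized_by_def)
  have card_f: "card (?f L) * card K = card L" if "subgroup L ?N" "K \<subseteq> L" for L
  proof -
    have "subgroup K (?N\<lparr>carrier := L\<rparr>)"
      using N.subgroup_incl[OF N.subgroup_axioms that] .
    then show ?thesis
      using group.lagrange[OF N.subgroup_imp_group[OF that(1)]]
      by (simp add: f_eq order_def)
  qed
  have in_N: "subgroup L ?N" "subgroup L G" "K \<subseteq> L" "L \<subseteq> normalizer G K" "K \<noteq> L" "normalized_by A \<phi> L"
    "\<exists>n. card L = p ^ n" "L \<subseteq> carrier G" if "L \<in> normally_above K" for L
  proof -
    show *: "subgroup L G" "K \<subseteq> L" "L \<subseteq> normalizer G K" "K \<noteq> L" "normalized_by A \<phi> L"
      "\<exists>n. card L = p ^ n" "L \<subseteq> carrier G"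
      using that by (auto simp: normally_above_def above_def p_subgroup_def dest: invariant_p_subgroupsD)
    show "subgroup L ?N"
      using subgroup_incl[OF *(1) sN *(3)] by (simp add: normalizer_group_def)
  qed
  have union_f: "\<Union> (?f L) = L" if L: "subgroup L G" "K \<subseteq> L" for L
  proof
    show "\<Union> (?f L) \<subseteq> L"
      using L(2) subgroup.m_closed[OF L(1)] by (auto simp: r_coset_def)
    show "L \<subseteq> \<Union> (?f L)"
      using rcos_self[OF _ K'(3)] subgroup.subset[OF L(1)] by blast
  qed
  have f_in: "?f L \<in> ?X" if L: "L \<in> normally_above K" for L
  proof -
    note L' = in_N[OF L]
    have sub: "subgroup (?f L) ?Q"
      using N.normal_subgroup_factorize[OF N.normal_axioms L'(3,1)]
      by (simp add: f_eq normalizer_quotient_def)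
    obtain n where "card L = p ^ n" using L'(7) by blast
    then have "card (?f L) dvd p ^ n" using card_f[OF L'(1,3)] by (metis dvd_triv_left)
    then have "p_subgroup p (?f L) ?Q"
      using sub prime_p by (auto simp: p_subgroup_def divides_primepow_nat)
    moreover have "?f L \<noteq> {\<one>\<^bsub>?Q\<^esub>}"
      using union_f[OF L'(2,3)] L'(5) oneQ by (metis cSup_singleton)
    moreover have "normalized_by A (quotient_action G \<phi> K) (?f L)"
      unfolding normalized_by_def
    proof
      fix a assume a: "a \<in> carrier A"
      have "quotient_action G \<phi> K a ` ?f L = (\<lambda>x. K #> \<phi> a x) ` L"
        using act_coset[OF a] L'(4) by (auto simp: image_image subset_iff intro!: image_cong)
      also have "\<dots> = ?f (\<phi> a ` L)" by (simp add: image_image)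
      also have "\<phi> a ` L = L" using L'(6) a by (simp add: normalized_by_def)
      finally show "quotient_action G \<phi> K a ` ?f L = ?f L" .
    qed
    ultimately show ?thesis by (simp add: normalized_p_poset_def)
  qed
  have union_in: "\<Union> M \<in> normally_above K" "?f (\<Union> M) = M" if "M \<in> ?X" for M
  proof -
    have M: "subgroup M ?Q" "\<exists>n. card M = p ^ n" "M \<noteq> {K}" "normalized_by A (quotient_action G \<phi> K) M"
      using that by (auto simp: normalized_p_poset_def p_subgroup_def oneQ)
    have M': "subgroup M (?N Mod K)" using M(1) by (simp add: normalizer_quotient_def)
    show f: "?f (\<Union> M) = M"
      using N.factgroup_subgroup_union_factor[OF M'] by (simp add: f_eq)
    have subN: "subgroup (\<Union> M) ?N" using N.factgroup_subgroup_union_subgroup[OF M'] .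
    then have sub: "subgroup (\<Union> M) G"
      using incl_subgroup[OF sN, of "\<Union> M"] by (simp add: normalizer_group_def)
    have "K \<in> M" using subgroup.one_closed[OF M(1)] by (simp add: oneQ)
    then have KM: "K \<subseteq> \<Union> M" by blast
    have KneM: "K \<noteq> \<Union> M"
    proof
      assume eq: "K = \<Union> M"
      have "?f K = (\<lambda>x. K) ` K"
        by (rule image_cong[OF refl]) (use coset_join2[OF _ K'(3)] K'(4) in auto)
      also have "\<dots> = {K}" using subgroup.one_closed[OF K'(3)] by auto
      finally show False using M(3) f eq by simp
    qed
    obtain n m where "card M = p ^ n" "card K = p ^ m"
      using M(2) K'(1) by (auto simp: p_subgroup_def)
    then have "card (\<Union> M) = p ^ (n + m)"
      using card_f[OF subN KM] f by (simp add: power_add)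
    then have "p_subgroup p (\<Union> M) G" using sub by (auto simp: p_subgroup_def)
    moreover have "normalized_by A \<phi> (\<Union> M)"
      unfolding normalized_by_def
    proof
      fix a assume a: "a \<in> carrier A"
      have "\<phi> a ` \<Union> M = \<Union> (quotient_action G \<phi> K a ` M)"
        using subgroup.subset[OF M(1)] by (auto simp: quotient_action_def)
      also have "quotient_action G \<phi> K a ` M = M"
        using M(4) a by (simp add: normalized_by_def)
      finally show "\<phi> a ` \<Union> M = \<Union> M" .
    qed
    moreover have "\<Union> M \<subseteq> normalizer G K"
      using subgroup.subset[OF subN] by (simp add: normalizer_group_def)
    ultimately show "\<Union> M \<in> normally_above K"
      using KM KneM by (auto simp: normally_above_def above_def invariant_p_subgroups_def)
  qed
  have bij: "bij_betw ?f (normally_above K) ?X"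
    by (rule bij_betw_byWitness[where f' = Union])
      (use union_f in_N(2,3) f_in union_in in auto)
  have "alt_chain_sum (normally_above K) = alt_chain_sum ?X"
  proof (rule alt_chain_sum_iso[OF bij])
    fix L M assume L: "L \<in> normally_above K" and M: "M \<in> normally_above K"
    show "?f L \<subseteq> ?f M \<longleftrightarrow> L \<subseteq> M"
      using union_f[OF in_N(2,3)[OF L]] union_f[OF in_N(2,3)[OF M]] by (metis Union_mono image_mono)
  qed
  also have "\<dots> = - reduced_euler_char ?X"
    using bij_betw_finite[OF bij] finite_above(2) by (intro alt_chain_sum_eq_reduced_euler_char) simp
  finally show ?thesis .
qed

section \<open>The three formulas\<close>

lemma alt_chain_sum_above:
  assumes "K \<in> invariant_p_subgroups"
  shows "alt_chain_sum (above K) = (if K \<in> normalized_radicals A \<phi> p G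
    then - reduced_euler_char
        (normalized_p_poset A (quotient_action G \<phi> K) p (normalizer_quotient G K))
    else 0)"
  using assms alt_chain_sum_above_eq_normally_above[OF assms]
    alt_chain_sum_normally_above_eq_quotient[OF assms] alt_chain_sum_normally_above_nonradical[OF assms]
    invariant_p_subgroupsD(2)[OF assms]
  by (auto simp: normalized_radicals_def)

lemma normalized_radicals_subset: "normalized_radicals A \<phi> p G \<subseteq> invariant_p_subgroups"
  by (auto simp: normalized_radicals_def invariant_p_subgroups_def radical_p_subgroup_def)

text \<open>
  Sums over the radical subgroups extend to all invariant \<open>p\<close>-subgroups, since the added
  terms vanish.
\<close>

lemma sum_normalized_radicals:
  "(\<Sum>K | K \<in> normalized_radicals A \<phi> p G \<and> P K.
      - reduced_euler_char
          (normalized_p_poset A (quotient_action G \<phi> K) p (normalizer_quotient G K)) * w K)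
    = (\<Sum>K | K \<in> invariant_p_subgroups \<and> P K. alt_chain_sum (above K) * w K)"
  by (rule sum.mono_neutral_cong_left)
    (use finite_invariant_p_subgroups normalized_radicals_subset alt_chain_sum_above in auto)

lemma sum_alt_chain_sum_above:
  assumes "H \<in> invariant_p_subgroups"
  shows "(\<Sum>K | K \<in> invariant_p_subgroups \<and> H \<subseteq> K. alt_chain_sum (above K)) = 1"
  using sum_upper_intervals_above[OF finite_invariant_p_subgroups assms] by (simp add: above_def)

text \<open>
  A subgroup contains \<open>x\<close> if and only if it contains the cyclic subgroup generated by \<open>x\<close>,
  which is invariant because \<open>A\<close> fixes it pointwise. So for \<open>p\<close>-singular \<open>x\<close> the sum runs over
  a principal upper set of the poset, and for any other \<open>x\<close> it is empty.
\<close>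

lemma sum_alt_chain_sum_containing:
  assumes x: "x \<in> fixed_points A \<phi> (carrier G)"
  shows "(\<Sum>K | K \<in> invariant_p_subgroups \<and> x \<in> K. alt_chain_sum (above K))
    = (if p_singular p G x then 1 else 0)"
proof -
  have xG: "x \<in> carrier G" using x by (simp add: fixed_points_def)
  let ?C = "generate G {x}"
  have sub: "subgroup ?C G" using xG by (intro generate_is_subgroup) auto
  have card: "card ?C = ord x" using generate_pow_card[OF xG] by simp
  have mem: "x \<in> K \<longleftrightarrow> ?C \<subseteq> K" if "K \<in> invariant_p_subgroups" for K
    using invariant_p_subgroupsD(3)[OF that] generate_subgroup_incl[of "{x}" K]
      generate.incl[of x "{x}" G] by blast
  show ?thesis
  proof (cases "p_singular p G x")
    case True
    then have "p_subgroup p ?C G" using sub card by (auto simp: p_singular_def p_subgroup_def)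
    moreover have "?C \<subseteq> fixed_points A \<phi> (carrier G)"
      using generate_subgroup_incl[OF _ fixed_points_subgroup] x by simp
    ultimately have "?C \<in> invariant_p_subgroups"
      using normalized_by_if_fixed by (simp add: invariant_p_subgroups_def)
    moreover have "{K. K \<in> invariant_p_subgroups \<and> x \<in> K} = {K. K \<in> invariant_p_subgroups \<and> ?C \<subseteq> K}"
      using mem by auto
    ultimately show ?thesis using sum_alt_chain_sum_above True by simp
  next
    case False
    have "x \<notin> K" if K: "K \<in> invariant_p_subgroups" for K
    proof
      assume "x \<in> K"
      then have "p_subgroup p ?C G"
        using p_subgroup_mono[OF prime_p invariant_p_subgroupsD(1)[OF K] sub] mem[OF K] by simp
      then show False using False xG card by (auto simp: p_singular_def p_subgroup_def)
    qed
    then have "{K. K \<in> invariant_p_subgroups \<and> x \<in> K} = {}" by auto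
    then show ?thesis using False by (simp only: sum.empty if_False)
  qed
qed

text \<open>
  Count the pairs of an invariant \<open>p\<close>-subgroup \<open>K\<close> and an element of \<open>C\<^sub>G(A)\<close> in it, weighted by
  \<open>K\<close>, in the other order.
\<close>

lemma sum_alt_chain_sum_times_fixed_points:
  "(\<Sum>K\<in>invariant_p_subgroups. alt_chain_sum (above K) * int (card (fixed_points A \<phi> K)))
    = int (card {x \<in> fixed_points A \<phi> (carrier G). p_singular p G x})"
proof -
  let ?F = "fixed_points A \<phi> (carrier G)"
  have finF: "finite ?F"
    using finite_carrier by (auto simp: fixed_points_def)
  have "int (card (fixed_points A \<phi> K)) = (\<Sum>x\<in>?F. if x \<in> K then 1 else 0)"
    if K: "K \<in> invariant_p_subgroups" for K
  proof -
    have "fixed_points A \<phi> K = ?F \<inter> K"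
      using invariant_p_subgroupsD(4)[OF K] by (auto simp: fixed_points_def)
    then show ?thesis using finF by (simp add: sum.If_cases)
  qed
  then have "(\<Sum>K\<in>invariant_p_subgroups. alt_chain_sum (above K) * int (card (fixed_points A \<phi> K)))
      = (\<Sum>K\<in>invariant_p_subgroups. \<Sum>x\<in>?F. if x \<in> K then alt_chain_sum (above K) else 0)"
    by (intro sum.cong) (auto simp: sum_distrib_left intro!: sum.cong)
  also have "\<dots> = (\<Sum>x\<in>?F. \<Sum>K\<in>invariant_p_subgroups. if x \<in> K then alt_chain_sum (above K) else 0)"
    by (rule sum.swap)
  also have "\<dots> = (\<Sum>x\<in>?F. if p_singular p G x then 1 else 0)"
    using sum_alt_chain_sum_containing finite_invariant_p_subgroups
    by (intro sum.cong) (auto simp: sum.If_cases Int_def)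
  also have "\<dots> = int (card {x \<in> ?F. p_singular p G x})"
    using finF by (simp add: sum.If_cases Int_def)
  finally show ?thesis .
qed

text \<open>
  The contraction \<open>L \<subseteq> L <#> Q \<supseteq> Q\<close>: the product is a \<open>p\<close>-subgroup because \<open>Q\<close> normalizes \<open>L\<close>,
  and it is invariant because \<open>Q\<close> is centralized by \<open>A\<close>.
\<close>

lemma alt_chain_sum_normalized_by_subgroup:
  assumes Q: "p_subgroup p Q G" "Q \<subseteq> fixed_points A \<phi> (carrier G)" "Q \<noteq> {\<one>}"
  shows "alt_chain_sum {L \<in> normalized_p_poset A \<phi> p G. Q \<subseteq> normalizer G L} = 0"
proof -
  let ?X = "{L \<in> normalized_p_poset A \<phi> p G. Q \<subseteq> normalizer G L}"
  have X: "L \<in> ?X \<longleftrightarrow> L \<in> invariant_p_subgroups \<and> L \<noteq> {\<one>} \<and> Q \<subseteq> normalizer G L" for L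
    by (auto simp: normalized_p_poset_def invariant_p_subgroups_def)
  have Q_inv: "Q \<in> invariant_p_subgroups"
    using Q normalized_by_if_fixed by (simp add: invariant_p_subgroups_def)
  have sub: "subgroup M G" if "M \<in> invariant_p_subgroups" for M
    using that by (rule invariant_p_subgroupsD(3))
  have one_ne: "M \<noteq> {\<one>}" if "Q \<subseteq> M" for M
    using that Q(3) subgroup.one_closed[OF sub[OF Q_inv]] by blast
  show ?thesis
  proof (rule alt_chain_sum_conically_contractible[where c = Q and j = "\<lambda>L. L <#> Q"])
    show "finite ?X"
      using finite_invariant_p_subgroups by (rule finite_subset[rotated]) (use X in auto)
    show "Q \<in> ?X" using X Q_inv Q(3) subgroup_le_normalizer[OF sub[OF Q_inv]] by simp
    fix L assume "L \<in> ?X"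
    then have L: "L \<in> invariant_p_subgroups" "Q \<subseteq> normalizer G L" using X by auto
    note prod = set_mult_invariant_p_subgroups[OF L(1) Q_inv L(2)]
    show "L <#> Q \<in> ?X"
      using X prod one_ne[OF prod(3)] subgroup_le_normalizer[OF sub[OF prod(1)]] by blast
    show "L \<subseteq> L <#> Q" "Q \<subseteq> L <#> Q" using prod by auto
  next
    fix L M assume "M \<in> ?X" "L \<subseteq> M" "Q \<subseteq> M"
    then show "L <#> Q \<subseteq> M" using set_mult_least[of M L Q] sub X by blast
  qed
qed

text \<open>
  Conjugation by an element that \<open>A\<close> fixes commutes with the action of \<open>A\<close>, and so it
  permutes the invariant \<open>p\<close>-subgroups.
\<close>

lemma group_action_on_chains:
  assumes P: "subgroup P G" "P \<subseteq> fixed_points A \<phi> (carrier G)"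
  shows "group_action (G\<lparr>carrier := P\<rparr>) (chains_in (normalized_p_poset A \<phi> p G))
    (\<lambda>g. \<lambda>C\<in>chains_in (normalized_p_poset A \<phi> p G). (\<lambda>L. g <# L #> inv g) ` C)"
proof -
  let ?X = "normalized_p_poset A \<phi> p G"
  let ?c = "\<lambda>g L. g <# L #> inv g"
  have PG: "P \<subseteq> carrier G" using P(1) by (rule subgroup.subset)
  have X: "subgroup L G" "L \<subseteq> carrier G" if "L \<in> ?X" for L
    using that by (auto simp: normalized_p_poset_def p_subgroup_def dest: subgroup.subset)
  interpret conj: group_action G "{H. H \<subseteq> carrier G}" "\<lambda>g. \<lambda>H\<in>{H. H \<subseteq> carrier G}. ?c g H"
    by (rule action_by_conjugation_on_power_set)
  have c_sub: "?c g L \<subseteq> carrier G" if "g \<in> carrier G" "L \<subseteq> carrier G" for g L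
    using that by (auto simp: conjugate_eq_image)
  have c_mult: "?c (g \<otimes> h) L = ?c g (?c h L)" if "g \<in> carrier G" "h \<in> carrier G" "L \<subseteq> carrier G" for g h L
    using conj.composition_rule[of L g h] that c_sub by simp
  have c_one: "?c \<one> L = L" if "L \<subseteq> carrier G" for L
    using that by (simp add: lcos_mult_one)
  have c_closed: "?c g L \<in> ?X" if g: "g \<in> P" and L: "L \<in> ?X" for g L
  proof -
    have gG: "g \<in> carrier G" using g PG by auto
    have card: "card (?c g L) = card L" using card_conjugate[OF gG X(2)[OF L]] .
    have p: "p_subgroup p (?c g L) G"
      using subgroup_conjugation_is_surj2[OF gG X(1)[OF L]] card L
      by (simp add: normalized_p_poset_def p_subgroup_def)
    have "?c g L \<noteq> {\<one>}"
    proof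
      assume "?c g L = {\<one>}"
      then have "card L = 1" using card by simp
      then have "L = {\<one>}"
        using subgroup.one_closed[OF X(1)[OF L]] by (auto simp: card_1_singleton_iff)
      then show False using L by (simp add: normalized_p_poset_def)
    qed
    moreover have "normalized_by A \<phi> (?c g L)"
    proof (subst normalized_by_iff[OF c_sub[OF gG X(2)[OF L]]], intro ballI)
      fix a assume a: "a \<in> carrier A"
      interpret a: group_hom G G "\<phi> a"
        using act_hom[OF a] by (simp add: group_hom_def group_hom_axioms_def is_group)
      have "\<phi> a g = g" using g P(2) a by (auto simp: fixed_points_def)
      moreover have "\<phi> a ` L = L" using L a by (simp add: normalized_p_poset_def normalized_by_def)
      ultimately show "\<phi> a ` ?c g L \<subseteq> ?c g L"
        using gG X(2)[OF L] by (simp add: coset_hom[OF a.homh] l_coset_subset_G)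
    qed
    ultimately show ?thesis using p by (simp add: normalized_p_poset_def)
  qed
  interpret P: group "G\<lparr>carrier := P\<rparr>" using P(1) by (rule subgroup_imp_group)
  show ?thesis
  proof (rule P.group_actionI)
    fix g C assume g: "g \<in> carrier (G\<lparr>carrier := P\<rparr>)" and C: "C \<in> chains_in ?X"
    have "?c g ` C \<subseteq> ?X" using g C c_closed by (auto simp: chains_in_def)
    moreover have "Complete_Partial_Order.chain (\<subseteq>) (?c g ` C)"
      using C unfolding chains_in_def chain_def conjugate_eq_image by (blast intro: image_mono)
    ultimately show "?c g ` C \<in> chains_in ?X" by (simp add: chains_in_def)
  next
    fix C assume "C \<in> chains_in ?X"
    then have "?c \<one> L = L" if "L \<in> C" for L using that c_one X(2) by (auto simp: chains_in_def)
    then show "?c \<one>\<^bsub>G\<lparr>carrier := P\<rparr>\<^esub> ` C = C" by simp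
  next
    fix g h C assume "g \<in> carrier (G\<lparr>carrier := P\<rparr>)" "h \<in> carrier (G\<lparr>carrier := P\<rparr>)" "C \<in> chains_in ?X"
    then have gh: "g \<in> carrier G" "h \<in> carrier G" and "C \<subseteq> Pow (carrier G)"
      using PG X(2) by (auto simp: chains_in_def)
    then have "?c (g \<otimes> h) L = ?c g (?c h L)" if "L \<in> C" for L using that c_mult by auto
    then show "?c (g \<otimes>\<^bsub>G\<lparr>carrier := P\<rparr>\<^esub> h) ` C = ?c g ` ?c h ` C"
      by (simp add: image_image)
  qed
qed

text \<open>
  Let \<open>P\<close> act by conjugation on the chains. The chains with trivial stabilizer form regular
  orbits, so their contribution is divisible by \<open>|P|\<close>. The other chains contribute 0: with
  Moebius weights \<open>m\<close> on the nontrivial subgroups of \<open>P\<close>, each of them is counted once when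
  it is counted \<open>m Q\<close> times for every nontrivial \<open>Q\<close> in its stabilizer. For fixed \<open>Q\<close> this
  gives \<open>m Q\<close> times the alternating sum over the chains of subgroups normalized by \<open>Q\<close>,
  which is 0.
\<close>

lemma order_dvd_alt_chain_sum:
  assumes P: "p_subgroup p P G" "P \<subseteq> fixed_points A \<phi> (carrier G)"
  shows "int (card P) dvd alt_chain_sum (normalized_p_poset A \<phi> p G)"
proof -
  let ?X = "normalized_p_poset A \<phi> p G"
  let ?c = "\<lambda>g L. g <# L #> inv g"
  let ?act = "\<lambda>g. \<lambda>C\<in>chains_in ?X. ?c g ` C"
  have sP: "subgroup P G" using P(1) by (simp add: p_subgroup_def)
  have PG: "P \<subseteq> carrier G" using sP by (rule subgroup.subset)
  have X: "L \<subseteq> carrier G" if "L \<in> ?X" for L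
    using that by (auto simp: normalized_p_poset_def p_subgroup_def dest: subgroup.subset)
  have finX: "finite ?X"
    using X finite_carrier by (intro finite_subset[of ?X "Pow (carrier G)"]) auto
  have finC: "finite (chains_in ?X)" using finX by (rule finite_chains_in)
  interpret act: group_action "G\<lparr>carrier := P\<rparr>" "chains_in ?X" ?act
    using group_action_on_chains[OF sP P(2)] .
  have ordP: "order (G\<lparr>carrier := P\<rparr>) = card P" by (simp add: order_def)
  have finP: "finite P" using PG finite_carrier by (rule finite_subset)
  let ?stab = "stabilizer (G\<lparr>carrier := P\<rparr>) ?act"
  have card_c: "card (?c g ` C) = card C" "card (?c g L) = card L"
    if "g \<in> P" "C \<in> chains_in ?X" "L \<in> C" for g C L
  proof -
    have gG: "g \<in> carrier G" using that(1) PG by auto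
    have C: "M \<subseteq> carrier G" if "M \<in> C" for M
      using that \<open>C \<in> chains_in ?X\<close> X by (auto simp: chains_in_def)
    have "inj_on (?c g) C"
      using gG C by (intro inj_onI) (metis subgroup_conjugation_is_inj)
    then show "card (?c g ` C) = card C" by (rule card_image)
    show "card (?c g L) = card L" using card_conjugate[OF gG C[OF that(3)]] .
  qed
  \<comment> \<open>An element that maps a chain to itself fixes every member, as comparable subgroups
    of the same order are equal.\<close>
  have stab: "Q \<subseteq> ?stab C \<longleftrightarrow> (\<forall>L\<in>C. Q \<subseteq> normalizer G L)"
    if C: "C \<in> chains_in ?X" and Q: "Q \<subseteq> P" for C Q
  proof -
    have fix_iff: "?c g ` C = C \<longleftrightarrow> (\<forall>L\<in>C. ?c g L = L)" if g: "g \<in> P" for g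
    proof
      assume eq: "?c g ` C = C"
      show "\<forall>L\<in>C. ?c g L = L"
      proof
        fix L assume L: "L \<in> C"
        then have "?c g L \<in> C" using eq by blast
        then have "?c g L \<subseteq> L \<or> L \<subseteq> ?c g L" "?c g L \<subseteq> carrier G" "L \<subseteq> carrier G"
          using C L X by (auto simp: chains_in_def chain_def)
        then show "?c g L = L"
          using card_c(2)[OF g C L] finite_carrier by (metis card_subset_eq finite_subset)
      qed
    qed simp
    have "g \<in> ?stab C \<longleftrightarrow> (\<forall>L\<in>C. g \<in> normalizer G L)" if g: "g \<in> P" for g
    proof -
      have "g \<in> ?stab C \<longleftrightarrow> ?c g ` C = C"
        using C g by (simp add: stabilizer_def)
      also have "\<dots> \<longleftrightarrow> (\<forall>L\<in>C. g \<in> normalizer G L)"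
        unfolding fix_iff[OF g]
      proof (rule ball_cong[OF refl])
        fix L assume "L \<in> C"
        then have "L \<subseteq> carrier G" using C X by (auto simp: chains_in_def)
        then show "?c g L = L \<longleftrightarrow> g \<in> normalizer G L"
          using mem_normalizer_conj g PG by auto
      qed
      finally show ?thesis .
    qed
    then have "g \<in> ?stab C \<longleftrightarrow> (\<forall>L\<in>C. g \<in> normalizer G L)" if "g \<in> Q" for g
      using Q that by (meson subsetD)
    then show ?thesis
      by (simp add: subset_iff) meson
  qed
  let ?T = "{Q. subgroup Q G \<and> Q \<subseteq> P \<and> Q \<noteq> {\<one>}}"
  have finT: "finite ?T" using finP by (intro finite_subset[of ?T "Pow P"]) auto
  obtain m :: "'a set \<Rightarrow> int" where m: "\<forall>R\<in>?T. (\<Sum>Q | Q \<in> ?T \<and> Q \<subseteq> R. m Q) = 1"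
    using moebius_weights_exist[OF finT] by blast
  let ?s = "\<lambda>C. (- 1 :: int) ^ card C"
  let ?free = "\<lambda>C. ?stab C = {\<one>}"
  have indicator: "(\<Sum>Q | Q \<in> ?T \<and> Q \<subseteq> ?stab C. m Q) = (if ?free C then 0 else 1)"
    if C: "C \<in> chains_in ?X" for C
  proof -
    have sub: "subgroup (?stab C) (G\<lparr>carrier := P\<rparr>)" using act.stabilizer_subgroup[OF C] .
    have subG: "subgroup (?stab C) G" using incl_subgroup[OF sP sub] .
    have subP: "?stab C \<subseteq> P" using subgroup.subset[OF sub] by simp
    show ?thesis
    proof (cases "?free C")
      case True
      have "{Q. Q \<in> ?T \<and> Q \<subseteq> ?stab C} = {}"
        using True by (auto dest: subgroup.one_closed)
      then show ?thesis using True by (simp only: sum.empty simp_thms if_True)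
    next
      case False
      then have "?stab C \<in> ?T" using subG subP by simp
      then have "(\<Sum>Q | Q \<in> ?T \<and> Q \<subseteq> ?stab C. m Q) = 1" using m by (rule bspec[rotated])
      then show ?thesis using False by (simp only: if_False)
    qed
  qed
  \<comment> \<open>Expand the indicator of having a nontrivial stabilizer and exchange the two sums.\<close>
  have "(\<Sum>C\<in>chains_in ?X. if ?free C then 0 else ?s C)
      = (\<Sum>C\<in>chains_in ?X. \<Sum>Q\<in>?T. if Q \<subseteq> ?stab C then m Q * ?s C else 0)"
  proof (rule sum.cong[OF refl])
    fix C assume C: "C \<in> chains_in ?X"
    have "(\<Sum>Q\<in>?T. if Q \<subseteq> ?stab C then m Q * ?s C else 0)
        = (\<Sum>Q | Q \<in> ?T \<and> Q \<subseteq> ?stab C. m Q * ?s C)"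
      by (rule sum.inter_filter[OF finT, symmetric])
    also have "\<dots> = (\<Sum>Q | Q \<in> ?T \<and> Q \<subseteq> ?stab C. m Q) * ?s C"
      by (rule sum_distrib_right[symmetric])
    finally show "(if ?free C then 0 else ?s C)
        = (\<Sum>Q\<in>?T. if Q \<subseteq> ?stab C then m Q * ?s C else 0)"
      by (simp only: indicator[OF C] split: if_split) simp
  qed
  also have "\<dots> = (\<Sum>Q\<in>?T. \<Sum>C\<in>chains_in ?X. if Q \<subseteq> ?stab C then m Q * ?s C else 0)"
    by (rule sum.swap)
  also have "\<dots> = (\<Sum>Q\<in>?T. 0)"
  proof (rule sum.cong[OF refl])
    fix Q assume Q: "Q \<in> ?T"
    have "Q \<subseteq> P" using Q by simp
    then have "{C \<in> chains_in ?X. Q \<subseteq> ?stab C} = {C \<in> chains_in ?X. \<forall>L\<in>C. Q \<subseteq> normalizer G L}"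
      by (intro Collect_cong conj_cong stab refl)
    also have "\<dots> = chains_in {L \<in> ?X. Q \<subseteq> normalizer G L}"
      by (auto simp: chains_in_def)
    finally have chains: "{C \<in> chains_in ?X. Q \<subseteq> ?stab C}
        = chains_in {L \<in> ?X. Q \<subseteq> normalizer G L}" .
    have "(\<Sum>C\<in>chains_in ?X. if Q \<subseteq> ?stab C then m Q * ?s C else 0)
        = (\<Sum>C | C \<in> chains_in ?X \<and> Q \<subseteq> ?stab C. m Q * ?s C)"
      by (rule sum.inter_filter[OF finC, symmetric])
    also have "\<dots> = m Q * alt_chain_sum {L \<in> ?X. Q \<subseteq> normalizer G L}"
      by (simp only: chains alt_chain_sum_def sum_distrib_left)
    also have "\<dots> = 0"
    proof -
      have "p_subgroup p Q G" using p_subgroup_mono[OF prime_p P(1), of Q] Q by simp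
      then show ?thesis
        using alt_chain_sum_normalized_by_subgroup[of Q] Q P(2) by auto
    qed
    finally show "(\<Sum>C\<in>chains_in ?X. if Q \<subseteq> ?stab C then m Q * ?s C else 0) = 0" .
  qed
  finally have nonfree: "(\<Sum>C\<in>chains_in ?X. if ?free C then 0 else ?s C) = 0" by simp
  let ?orb = "orbit (G\<lparr>carrier := P\<rparr>) ?act"
  have free_iff: "?free C \<longleftrightarrow> card (?orb C) = card P" if C: "C \<in> chains_in ?X" for C
  proof -
    have prod: "card (?orb C) * card (?stab C) = card P"
      using act.orbit_stabilizer_theorem[OF C] ordP by simp
    have "\<one> \<in> ?stab C" using act.stabilizer_one_closed[OF C] by simp
    then have "?free C \<longleftrightarrow> card (?stab C) = 1" by (auto simp: card_1_singleton_iff)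
    moreover have "card P > 0"
      using finP subgroup.one_closed[OF sP] by (auto simp: card_gt_0_iff)
    moreover have "s = 1 \<longleftrightarrow> t = n" if "t * s = n" "n > 0" for s t n :: nat
      using that by auto
    ultimately show ?thesis using prod by blast
  qed
  \<comment> \<open>Freeness is tested by the size of the orbit, which is visibly constant on orbits.\<close>
  have "int (card P) dvd (\<Sum>C\<in>chains_in ?X. if card (?orb C) = card P then ?s C else 0)"
  proof (rule act.dvd_sum_of_dvd_orbit_sums[OF finC])
    fix g C assume g: "g \<in> carrier (G\<lparr>carrier := P\<rparr>)" and C: "C \<in> chains_in ?X"
    have gC: "?act g C \<in> chains_in ?X" using act.element_image[OF g C refl] .
    have "?act g C \<in> ?orb C" "?act g C \<in> ?orb (?act g C)"
      using g act.orbit_refl[OF gC] by (auto simp: orbit_def)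
    then have "?orb (?act g C) = ?orb C"
      using act.disjoint_union[of "?orb (?act g C)" "?orb C"] C gC by (auto simp: orbits_def)
    moreover have "card (?act g C) = card C"
    proof (cases "C = {}")
      case False
      then show ?thesis using card_c(1)[of g C] g C by auto
    qed (use C in simp)
    ultimately show "(if card (?orb (?act g C)) = card P then ?s (?act g C) else 0)
        = (if card (?orb C) = card P then ?s C else 0)" by simp
  qed auto
  also have "(\<Sum>C\<in>chains_in ?X. if card (?orb C) = card P then ?s C else 0)
      = (\<Sum>C\<in>chains_in ?X. if ?free C then ?s C else 0)"
    using free_iff by (intro sum.cong) auto
  also have "\<dots> = (\<Sum>C\<in>chains_in ?X. if ?free C then ?s C else 0)
      + (\<Sum>C\<in>chains_in ?X. if ?free C then 0 else ?s C)"
    using nonfree by simp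
  also have "\<dots> = alt_chain_sum ?X"
    unfolding alt_chain_sum_def sum.distrib[symmetric] by (intro sum.cong refl) simp
  finally show ?thesis .
qed

end

theorem theorem1p1:
  fixes A :: "('c, 'd) monoid_scheme"
    and G :: "('a, 'b) monoid_scheme"
    and \<phi> :: "'c \<Rightarrow> 'a \<Rightarrow> 'a"
    and p :: nat
  assumes "group A" and "finite (carrier A)"
    and "group G" and "finite (carrier G)"
    and "\<phi> \<in> hom A (AutoGroup G)"
    and "Factorial_Ring.prime p"
  shows "((\<Sum>H\<in>normalized_radicals A \<phi> p G.
            - reduced_euler_char
                (normalized_p_poset A (quotient_action G \<phi> H) p (normalizer_quotient G H))
            * int (card (fixed_points A \<phi> H)))
          = int (card {x \<in> fixed_points A \<phi> (carrier G). p_singular p G x})) \<and>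
         (\<forall>H\<in>normalized_radicals A \<phi> p G.
          (\<Sum>K\<in>{K \<in> normalized_radicals A \<phi> p G. H \<subseteq> K}.
            - reduced_euler_char
                (normalized_p_poset A (quotient_action G \<phi> K) p (normalizer_quotient G K)))
          = 1) \<and>
         (int (p ^ multiplicity p (card (fixed_points A \<phi> (carrier G))))
          dvd reduced_euler_char (normalized_p_poset A \<phi> p G))"
proof (intro conjI ballI)
  interpret group_with_operators G A \<phi> p
    using assms by (simp add: group_with_operators_def group_with_operators_axioms_def)
  show "(\<Sum>H\<in>normalized_radicals A \<phi> p G.
      - reduced_euler_char
          (normalized_p_poset A (quotient_action G \<phi> H) p (normalizer_quotient G H))
      * int (card (fixed_points A \<phi> H)))
    = int (card {x \<in> fixed_points A \<phi> (carrier G). p_singular p G x})"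
    using sum_normalized_radicals[where P = "\<lambda>_. True" and w = "\<lambda>H. int (card (fixed_points A \<phi> H))"]
      sum_alt_chain_sum_times_fixed_points by simp
  show "(\<Sum>K\<in>{K \<in> normalized_radicals A \<phi> p G. H \<subseteq> K}.
      - reduced_euler_char
          (normalized_p_poset A (quotient_action G \<phi> K) p (normalizer_quotient G K))) = 1"
    if "H \<in> normalized_radicals A \<phi> p G" for H
  proof -
    have "H \<in> invariant_p_subgroups" using that normalized_radicals_subset by blast
    then show ?thesis
      using sum_normalized_radicals[where P = "\<lambda>K. H \<subseteq> K" and w = "\<lambda>_. 1"] sum_alt_chain_sum_above by simp
  qed
  let ?C = "fixed_points A \<phi> (carrier G)"
  let ?m = "multiplicity p (card ?C)"
  let ?X = "normalized_p_poset A \<phi> p G"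
  have sC: "subgroup ?C G" by (rule fixed_points_subgroup)
  have finC: "finite ?C" using subgroup.subset[OF sC] finite_carrier by (rule finite_subset)
  have "order (G\<lparr>carrier := ?C\<rparr>) = p ^ ?m * (card ?C div p ^ ?m)"
    using multiplicity_dvd[of p "card ?C"] by (simp add: order_def)
  \<comment> \<open>By Sylow's theorem in \<open>C\<^sub>G(A)\<close>, the \<open>p\<close>-part of its order is the order of a \<open>p\<close>-subgroup.\<close>
  from sylow_thm[OF prime_p subgroup_imp_group[OF sC] this]
  obtain P where P: "subgroup P (G\<lparr>carrier := ?C\<rparr>)" "card P = p ^ ?m"
    using finC by auto
  then have "p_subgroup p P G" using incl_subgroup[OF sC] by (auto simp: p_subgroup_def)
  moreover have "P \<subseteq> ?C" using subgroup.subset[OF P(1)] by simp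
  ultimately have "int (p ^ ?m) dvd alt_chain_sum ?X"
    using order_dvd_alt_chain_sum P(2) by metis
  moreover have "finite ?X"
    using finite_invariant_p_subgroups
    by (rule finite_subset[rotated]) (auto simp: normalized_p_poset_def invariant_p_subgroups_def)
  ultimately show "int (p ^ ?m) dvd reduced_euler_char ?X"
    by (simp add: alt_chain_sum_eq_reduced_euler_char)
qed

end
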